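(* Let $m\ge 1$, let $n,p$ be positive integers, let $\alpha\in\mathbb{C}^*$, let $U(t)\in\mathbb{C}\{t\}$ with $U(0)=1$, and let $f:(\mathbb{C}^m,\mathbf{0})\to(\mathbb{C},0)$ be a germ of a nonzero holomorphic function, written $f=f_1^{r_1}\cdots f_k^{r_k}$ as a product of powers of pairwise non-associated irreducible germs $f_i$ with exponents $r_i\geq 1$, such that $\gcd(r_1,\ldots,r_k)=1$. Let $(\mathbf{x},z)$ be coordinates on $(\mathbb{C}^{m+1},\mathbf{0})$ and $(t,z)$ coordinates on $(\mathbb{C}^2,\mathbf{0})$, and set $$\Omega_{f,n,p,\alpha,U}=d\big(z^2+f(\mathbf{x})^n\big)+\alpha f(\mathbf{x})^pU(f(\mathbf{x}))\,dz,\qquad \omega_{n,p,\alpha,U}=d(z^2+t^n)+\alpha t^pU(t)\,dz .$$ Assume that $\Omega_{f,n,p,\alpha,U}$ has a nilpotent singularity at the origin, i.e. its first-order part at the origin is $2z\,dz$. Then the germ of holomorphic foliation on $(\mathbb{C}^{m+1},\mathbf{0})$ generated by $\Omega_{f,n,p,\alpha,U}$ has a holomorphic first integral if and only if the germ of holomorphic foliation on $(\mathbb{C}^2,\mathbf{0})$ generated by $\omega_{n,p,\alpha,U}$ has a holomorphic first integral.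
   Context: A holomorphic first integral of the germ of codimension one foliation generated by an integrable holomorphic 1-form $\eta$ on $(\mathbb{C}^N,\mathbf{0})$ is a non-constant germ of holomorphic function $h$ at $\mathbf{0}$ with $dh\wedge\eta=0$. $\mathbb{C}\{t\}$ denotes the ring of convergent power series. Note that $\Omega_{f,n,p,\alpha,U}=\Phi^*\omega_{n,p,\alpha,U}$ for $\Phi(\mathbf{x},z)=(f(\mathbf{x}),z)$. *)

theory Defs
  imports
    "HOL-Analysis.Analysis"
    "HOL-Computational_Algebra.Computational_Algebra"
begin

text \<open>
  Equivalent to the existence of a convergent power series expansion at the origin, by the
  theorems of Hartogs and Osgood.
\<close>

definition holomorphic_at_0 :: "(complex^'n::finite \<Rightarrow> complex) \<Rightarrow> bool" where
  "holomorphic_at_0 f \<longleftrightarrow>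
     (\<forall>\<^sub>F x in nhds 0. \<exists>D. (f has_derivative D) (at x) \<and> (\<forall>c v. D (c *s v) = c * D v))"

definition germ_rel :: "(complex^'n::finite \<Rightarrow> complex) \<Rightarrow> (complex^'n \<Rightarrow> complex) \<Rightarrow> bool" where
  "germ_rel f g \<longleftrightarrow> holomorphic_at_0 f \<and> holomorphic_at_0 g \<and> (\<forall>\<^sub>F x in nhds 0. f x = g x)"

lemma holomorphic_at_0_const: "holomorphic_at_0 (\<lambda>_. c)"
  unfolding holomorphic_at_0_def
  by (rule always_eventually, rule allI, rule exI[of _ "\<lambda>_. 0"]) simp

lemma holomorphic_at_0_uminus: "holomorphic_at_0 f \<Longrightarrow> holomorphic_at_0 (\<lambda>x. - f x)"
  unfolding holomorphic_at_0_def
proof (erule eventually_mono, elim exE conjE)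
  fix x D assume "(f has_derivative D) (at x)" "\<forall>c v. D (c *s v) = c * D v"
  then show "\<exists>D. ((\<lambda>x. - f x) has_derivative D) (at x) \<and> (\<forall>c v. D (c *s v) = c * D v)"
    by (intro exI[of _ "\<lambda>v. - D v"]) (auto intro!: derivative_eq_intros)
qed

lemma holomorphic_at_0_add:
  assumes "holomorphic_at_0 f" "holomorphic_at_0 g"
  shows "holomorphic_at_0 (\<lambda>x. f x + g x)"
  using assms unfolding holomorphic_at_0_def
proof (rule eventually_elim2, elim exE conjE)
  fix x D E
  assume "(f has_derivative D) (at x)" "\<forall>c v. D (c *s v) = c * D v"
    "(g has_derivative E) (at x)" "\<forall>c v. E (c *s v) = c * E v"
  then show "\<exists>D. ((\<lambda>x. f x + g x) has_derivative D) (at x) \<and> (\<forall>c v. D (c *s v) = c * D v)"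
    by (intro exI[of _ "\<lambda>v. D v + E v"]) (auto intro!: derivative_eq_intros simp: algebra_simps)
qed

lemma holomorphic_at_0_mult:
  assumes "holomorphic_at_0 f" "holomorphic_at_0 g"
  shows "holomorphic_at_0 (\<lambda>x. f x * g x)"
  using assms unfolding holomorphic_at_0_def
proof (rule eventually_elim2, elim exE conjE)
  fix x D E
  assume "(f has_derivative D) (at x)" "\<forall>c v. D (c *s v) = c * D v"
    "(g has_derivative E) (at x)" "\<forall>c v. E (c *s v) = c * E v"
  then show "\<exists>D. ((\<lambda>x. f x * g x) has_derivative D) (at x) \<and> (\<forall>c v. D (c *s v) = c * D v)"
    by (intro exI[of _ "\<lambda>v. f x * E v + D v * g x"])
       (auto intro!: derivative_eq_intros simp: algebra_simps)
qed

text \<open>The local ring $\mathcal{O}_n$ of germs at the origin of $\mathbb{C}^n$.\<close>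

quotient_type (overloaded) 'n hgerm = "complex^'n::finite \<Rightarrow> complex" / partial: germ_rel
  morphisms rep_hgerm hgerm_of
proof (rule part_equivpI)
  show "\<exists>f::complex^'n \<Rightarrow> complex. germ_rel f f"
    by (rule exI[of _ "\<lambda>_. 0"]) (simp add: germ_rel_def holomorphic_at_0_const)
  show "symp (germ_rel :: (complex^'n \<Rightarrow> complex) \<Rightarrow> _)"
    by (auto simp: symp_def germ_rel_def eq_commute)
  show "transp (germ_rel :: (complex^'n \<Rightarrow> complex) \<Rightarrow> _)"
    by (auto simp: transp_def germ_rel_def elim: eventually_elim2)
qed

instantiation hgerm :: (finite) comm_ring_1
begin

lift_definition zero_hgerm :: "'a hgerm" is "\<lambda>_. 0"
  by (simp add: germ_rel_def holomorphic_at_0_const)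

lift_definition one_hgerm :: "'a hgerm" is "\<lambda>_. 1"
  by (simp add: germ_rel_def holomorphic_at_0_const)

lift_definition plus_hgerm :: "'a hgerm \<Rightarrow> 'a hgerm \<Rightarrow> 'a hgerm" is "\<lambda>f g x. f x + g x"
  by (auto simp: germ_rel_def holomorphic_at_0_add elim: eventually_elim2)

lift_definition times_hgerm :: "'a hgerm \<Rightarrow> 'a hgerm \<Rightarrow> 'a hgerm" is "\<lambda>f g x. f x * g x"
  by (auto simp: germ_rel_def holomorphic_at_0_mult elim: eventually_elim2)

lift_definition uminus_hgerm :: "'a hgerm \<Rightarrow> 'a hgerm" is "\<lambda>f x. - f x"
  by (auto simp: germ_rel_def holomorphic_at_0_uminus elim: eventually_mono)

definition minus_hgerm :: "'a hgerm \<Rightarrow> 'a hgerm \<Rightarrow> 'a hgerm" where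
  "minus_hgerm f g = f + - g"

instance
proof
  fix a b c :: "'a hgerm"
  show "a * b * c = a * (b * c)"
    by transfer (auto simp: germ_rel_def mult.assoc intro!: holomorphic_at_0_mult)
  show "a * b = b * a"
    by transfer (auto simp: germ_rel_def mult.commute intro!: holomorphic_at_0_mult)
  show "1 * a = a"
    by transfer (auto simp: germ_rel_def)
  show "a + b + c = a + (b + c)"
    by transfer (auto simp: germ_rel_def add.assoc intro!: holomorphic_at_0_add)
  show "a + b = b + a"
    by transfer (auto simp: germ_rel_def add.commute intro!: holomorphic_at_0_add)
  show "0 + a = a"
    by transfer (auto simp: germ_rel_def)
  show "- a + a = 0"
    by transfer (auto simp: germ_rel_def holomorphic_at_0_const)
  show "a - b = a + - b"
    by (rule minus_hgerm_def)
  show "(a + b) * c = a * c + b * c"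
    by transfer (auto simp: germ_rel_def distrib_right
        intro!: holomorphic_at_0_mult holomorphic_at_0_add)
  show "0 \<noteq> (1 :: 'a hgerm)"
    by transfer (auto simp: germ_rel_def trivial_limit_def dest: eventually_nhds_x_imp_x)
qed

end

text \<open>
  The first argument is the point, the second the tangent vector. Germs of one-forms are
  represented by arbitrary representatives: every notion below depends only on the values near
  the origin.
\<close>

type_synonym 'n one_form = "complex^'n \<Rightarrow> complex^'n \<Rightarrow> complex"

definition ext_d :: "(complex^'n::finite \<Rightarrow> complex) \<Rightarrow> 'n one_form" where
  "ext_d h x = frechet_derivative h (at x)"

definition wedge ::
    "'n::finite one_form \<Rightarrow> 'n one_form \<Rightarrow> complex^'n \<Rightarrow> complex^'n \<Rightarrow> complex^'n \<Rightarrow> complex" where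
  "wedge \<theta> \<eta> x u v = \<theta> x u * \<eta> x v - \<theta> x v * \<eta> x u"

definition holomorphic_first_integral :: "'n::finite one_form \<Rightarrow> (complex^'n \<Rightarrow> complex) \<Rightarrow> bool" where
  "holomorphic_first_integral \<eta> h \<longleftrightarrow>
     holomorphic_at_0 h \<and>
     (\<nexists>c. \<forall>\<^sub>F x in nhds 0. h x = c) \<and>
     (\<forall>\<^sub>F x in nhds 0. \<forall>u v. wedge (ext_d h) \<eta> x u v = 0)"

text \<open>
  The one-form vanishes at the origin and the homogeneous linear part of its
  coefficients there is that of \<open>\<theta>\<close>.
\<close>

definition has_first_order_part :: "'n::finite one_form \<Rightarrow> 'n one_form \<Rightarrow> bool" where
  "has_first_order_part \<eta> \<theta> \<longleftrightarrow>
     (\<forall>u. \<eta> 0 u = 0 \<and> ((\<lambda>x. \<eta> x u) has_derivative (\<lambda>x. \<theta> x u)) (at 0))"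

text \<open>
  Points of $\mathbb{C}^{m+1}$ with coordinates $(\mathbf{x}, z)$ are vectors indexed by
  \<open>'m option\<close>, where \<open>None\<close> indexes \<open>z\<close>; on $\mathbb{C}^2$ the coordinates $(t, z)$ are the
  components 1 and 2.
\<close>

definition x_coord :: "complex^('m::finite option) \<Rightarrow> complex^'m" where
  "x_coord q = (\<chi> i. q $ Some i)"

definition z_coord :: "complex^('m::finite option) \<Rightarrow> complex" where
  "z_coord q = q $ None"

definition Omega_form ::
    "(complex^'m::finite \<Rightarrow> complex) \<Rightarrow> nat \<Rightarrow> nat \<Rightarrow> complex \<Rightarrow> complex fps \<Rightarrow> 'm option one_form" where
  "Omega_form f n p \<alpha> U q u =
     ext_d (\<lambda>q. z_coord q ^ 2 + f (x_coord q) ^ n) q u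
     + \<alpha> * f (x_coord q) ^ p * eval_fps U (f (x_coord q)) * ext_d z_coord q u"

definition omega_form :: "nat \<Rightarrow> nat \<Rightarrow> complex \<Rightarrow> complex fps \<Rightarrow> 2 one_form" where
  "omega_form n p \<alpha> U q u =
     ext_d (\<lambda>q. (q $ 2) ^ 2 + (q $ 1) ^ n) q u
     + \<alpha> * (q $ 1) ^ p * eval_fps U (q $ 1) * ext_d (\<lambda>q. q $ 2) q u"

end

theory Submission
  imports Defs "HOL-Complex_Analysis.Complex_Analysis"
begin

text \<open>
  Write \<open>\<Phi>(x, z) = (f(x), z)\<close>, so that \<open>\<Omega> = \<Phi>\<^sup>* \<omega>\<close>. If \<open>H\<close> is a first integral of \<open>\<omega>\<close>, then \<open>H \<circ> \<Phi>\<close> is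
  one of \<open>\<Omega>\<close>: pulling back preserves \<open>dH \<and> \<omega> = 0\<close>, and \<open>H \<circ> \<Phi>\<close> is not constant because \<open>\<Phi>\<close> maps
  neighbourhoods of the origin onto neighbourhoods of the origin
  (\<open>first_integral_pullback_by_germ\<close>).

  For the converse (\<open>first_integral_descends\<close>) let \<open>h\<close> be a first integral of \<open>\<Omega>\<close>. Pick a point
  \<open>q0 = (v, z0)\<close> near the origin with \<open>h q0 \<noteq> h 0\<close> and \<open>f v \<noteq> 0\<close>, and restrict everything to the plane of
  points \<open>(s v, z)\<close>. There \<open>f (s v)\<close> is a nonzero function of the single variable \<open>s\<close>, hence a power
  \<open>\<sigma> ^ \<nu>\<close> in a suitable coordinate \<open>s = g \<sigma>\<close> (\<open>power_normal_form\<close>). Every local branch of the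
  \<open>\<nu>\<close>-th root of \<open>t\<close> yields a section \<open>(t, z) \<mapsto> (g (t\<^sup>1\<^sup>/\<^sup>\<nu>) v, z)\<close> of \<open>\<Phi>\<close>, and a section pulls
  \<open>\<Omega> = \<Phi>\<^sup>* \<omega>\<close> back to \<open>\<omega>\<close>; so \<open>h\<close> composed with the section satisfies \<open>dh \<and> \<omega> = 0\<close>, but
  it depends on the branch and makes sense only near points with \<open>t \<noteq> 0\<close>. The product of \<open>h - h 0\<close> over all \<open>\<nu>\<close> branches,
  \[ H(t, z) = \prod_{w^\nu = 1} \bigl(h(g(w\, t^{1/\nu}) v, z) - h(0)\bigr), \]
  is single valued, and it satisfies \<open>dH \<and> \<omega> = 0\<close> since products of first integrals are first integrals.

  Over \<open>t = 0\<close> the function \<open>H\<close> is continuous, hence holomorphic in \<open>t\<close> by removal of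
  singularities, and it is holomorphic in \<open>z\<close>; so it is jointly differentiable with continuous partial
  derivatives (\<open>osgood_two_variables\<close>), and \<open>dH \<and> \<omega> = 0\<close> extends to \<open>t = 0\<close> by continuity
  (\<open>first_integral_extends_across_line\<close>). Finally \<open>H\<close> vanishes at the origin, but it is not identically
  zero: by the choice of \<open>q0\<close>, for suitable arbitrarily small \<open>z\<close> each of its finitely many factors is
  a nonzero holomorphic function of \<open>\<sigma> = t\<^sup>1\<^sup>/\<^sup>\<nu>\<close>, with isolated zeros.
\<close>

section \<open>Pointwise first integrals\<close>

definition complex_diff_at :: "(complex^'n::finite \<Rightarrow> complex) \<Rightarrow> complex^'n \<Rightarrow> bool" where
  "complex_diff_at F x \<longleftrightarrow>
     (\<exists>D. (F has_derivative D) (at x) \<and> (\<forall>c v. D (c *s v) = c * D v))"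

text \<open>
  The condition \<open>dh \<and> \<eta> = 0\<close> at one point, together with complex differentiability there. A pointwise
  notion can be transported along maps that exist only near a single point, such as the branches of a root.
\<close>

definition first_integral_at ::
    "'n::finite one_form \<Rightarrow> (complex^'n \<Rightarrow> complex) \<Rightarrow> complex^'n \<Rightarrow> bool" where
  "first_integral_at \<eta> h x \<longleftrightarrow>
     (\<exists>D. (h has_derivative D) (at x) \<and> (\<forall>c v. D (c *s v) = c * D v) \<and>
          (\<forall>u v. D u * \<eta> x v = D v * \<eta> x u))"

lemma first_integral_at_imp_complex_diff:
  "first_integral_at \<eta> h x \<Longrightarrow> complex_diff_at h x"
  unfolding first_integral_at_def complex_diff_at_def by blast

lemma complex_diff_at_imp_isCont: "complex_diff_at F x \<Longrightarrow> isCont F x"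
  unfolding complex_diff_at_def by (blast dest: has_derivative_continuous)

lemma first_integral_at_iff:
  "first_integral_at \<eta> h x \<longleftrightarrow> complex_diff_at h x \<and> (\<forall>u v. wedge (ext_d h) \<eta> x u v = 0)"
proof -
  have "(\<forall>u v. wedge (ext_d h) \<eta> x u v = 0) \<longleftrightarrow> (\<forall>u v. D u * \<eta> x v = D v * \<eta> x u)"
    if "(h has_derivative D) (at x)" for D
    using frechet_derivative_at[OF that] by (simp add: wedge_def ext_d_def)
  then show ?thesis
    unfolding first_integral_at_def complex_diff_at_def by blast
qed

lemma holomorphic_first_integral_iff:
  "holomorphic_first_integral \<eta> h \<longleftrightarrow>
     (\<forall>\<^sub>F x in nhds 0. first_integral_at \<eta> h x) \<and> \<not> (\<forall>\<^sub>F x in nhds 0. h x = h 0)"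
proof -
  have "(\<nexists>c. \<forall>\<^sub>F x in nhds 0. h x = c) \<longleftrightarrow> \<not> (\<forall>\<^sub>F x in nhds 0. h x = h 0)"
    using eventually_nhds_x_imp_x by fastforce
  then show ?thesis
    unfolding holomorphic_first_integral_def holomorphic_at_0_def
      complex_diff_at_def[symmetric] first_integral_at_iff
    by (auto simp: eventually_conj_iff)
qed

text \<open>
  If \<open>\<theta> = \<Psi>\<^sup>* \<eta>\<close> at \<open>q\<close>, then \<open>d(h \<circ> \<Psi>) \<and> \<theta> = \<Psi>\<^sup>* (dh \<and> \<eta>)\<close> at \<open>q\<close>, by the chain rule. Both implications
  of the theorem use this: one with \<open>\<Psi> = \<Phi>\<close>, the other with sections of \<open>\<Phi>\<close>.
\<close>

lemma first_integral_at_pullback: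
  assumes h: "first_integral_at \<eta> h (\<Psi> q)"
    and \<Psi>: "(\<Psi> has_derivative P) (at q)" "\<And>c u. P (c *s u) = c *s P u"
    and eq: "\<And>u. \<eta> (\<Psi> q) (P u) = \<theta> q u"
  shows "first_integral_at \<theta> (\<lambda>x. h (\<Psi> x)) q"
proof -
  from h obtain D where D: "(h has_derivative D) (at (\<Psi> q))" "\<And>c v. D (c *s v) = c * D v"
    "\<And>u v. D u * \<eta> (\<Psi> q) v = D v * \<eta> (\<Psi> q) u"
    unfolding first_integral_at_def by blast
  have "((\<lambda>x. h (\<Psi> x)) has_derivative (\<lambda>u. D (P u))) (at q)"
    using has_derivative_compose[OF \<Psi>(1) D(1)] .
  moreover have "D (P u) * \<theta> q v = D (P v) * \<theta> q u" for u v
    using D(3)[of "P u" "P v"] by (simp add: eq)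
  ultimately show ?thesis
    unfolding first_integral_at_def using D(2) \<Psi>(2) by (intro exI[of _ "\<lambda>u. D (P u)"]) simp
qed

lemma first_integral_at_diff_const:
  assumes "first_integral_at \<eta> h q"
  shows "first_integral_at \<eta> (\<lambda>x. h x - c) q"
proof -
  obtain D where D: "(h has_derivative D) (at q)" "\<And>c v. D (c *s v) = c * D v"
    "\<And>u v. D u * \<eta> q v = D v * \<eta> q u"
    using assms unfolding first_integral_at_def by blast
  from has_derivative_diff[OF D(1) has_derivative_const[of c]]
  have "((\<lambda>x. h x - c) has_derivative D) (at q)" by simp
  with D show ?thesis unfolding first_integral_at_def by blast
qed

text \<open>
  By the Leibniz rule the differential of a product is a combination of the differentials of its
  factors, and each of these is annihilated by wedging with \<open>\<eta>\<close>.
\<close>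

lemma first_integral_at_prod:
  assumes "finite R" "\<And>w. w \<in> R \<Longrightarrow> first_integral_at \<eta> (h w) q"
  shows "first_integral_at \<eta> (\<lambda>x. \<Prod>w\<in>R. h w x) q"
  using assms
proof (induction R rule: finite_induct)
  case empty
  show ?case unfolding first_integral_at_def by (auto intro!: exI[of _ "\<lambda>_. 0"])
next
  case (insert a R)
  obtain D where D: "(h a has_derivative D) (at q)" "\<And>c v. D (c *s v) = c * D v"
    "\<And>u v. D u * \<eta> q v = D v * \<eta> q u"
    using insert.prems unfolding first_integral_at_def by blast
  obtain E where E: "((\<lambda>x. \<Prod>w\<in>R. h w x) has_derivative E) (at q)" "\<And>c v. E (c *s v) = c * E v"
    "\<And>u v. E u * \<eta> q v = E v * \<eta> q u"
    using insert unfolding first_integral_at_def by blast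
  let ?G = "\<lambda>u. h a q * E u + D u * (\<Prod>w\<in>R. h w q)"
  have "((\<lambda>x. \<Prod>w\<in>insert a R. h w x) has_derivative ?G) (at q)"
    using has_derivative_mult[OF D(1) E(1)] insert.hyps by simp
  moreover have "?G (c *s v) = c * ?G v" for c v
    by (simp add: D E algebra_simps)
  moreover have "?G u * \<eta> q v = ?G v * \<eta> q u" for u v
  proof -
    have "?G u * \<eta> q v = h a q * (E u * \<eta> q v) + (D u * \<eta> q v) * (\<Prod>w\<in>R. h w q)"
      by (simp add: algebra_simps)
    also have "\<dots> = ?G v * \<eta> q u"
      unfolding D(3)[of u v] E(3)[of u v] by (simp add: algebra_simps)
    finally show ?thesis .
  qed
  ultimately show ?case unfolding first_integral_at_def by blast
qed

lemma first_integral_at_transform: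
  assumes "first_integral_at \<eta> h q" "\<forall>\<^sub>F x in nhds q. h x = h' x"
  shows "first_integral_at \<eta> h' q"
proof -
  from assms(2) obtain S where "open S" "q \<in> S" "\<And>x. x \<in> S \<Longrightarrow> h x = h' x"
    unfolding eventually_nhds by blast
  with assms(1) show ?thesis
    unfolding first_integral_at_def using has_derivative_transform_within_open by blast
qed

section \<open>Restriction to complex lines\<close>

lemma linear_scalar_line: "bounded_linear (\<lambda>s. s *s (a::complex^'n::finite))"
  by (intro linear_conv_bounded_linear[THEN iffD1] linearI)
     (auto simp: vec_eq_iff vector_scalar_mult_def algebra_simps)

lemma has_derivative_scalar_mult [derivative_intros]:
  assumes "(g has_derivative g') F"
  shows "((\<lambda>x. g x *s (a::complex^'n::finite)) has_derivative (\<lambda>u. g' u *s a)) F"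
  using bounded_linear.has_derivative[OF linear_scalar_line assms] .

lemma continuous_on_scalar_mult [continuous_intros]:
  "continuous_on S g \<Longrightarrow> continuous_on S (\<lambda>x. g x *s (a::complex^'n::finite))"
  using bounded_linear.continuous_on[OF linear_scalar_line] .

lemma norm_scalar_mult: "norm (s *s (a::complex^'n::finite)) = norm s * norm a"
proof -
  have "(\<Sum>i\<in>UNIV. (norm (s * vec_nth a i))\<^sup>2) = (norm s)\<^sup>2 * (\<Sum>i\<in>UNIV. (norm (vec_nth a i))\<^sup>2)"
    by (simp add: norm_mult power_mult_distrib sum_distrib_left)
  then show ?thesis by (simp add: norm_vec_def L2_set_def real_sqrt_mult)
qed

lemma open_line_preimage:
  assumes "open S" shows "open {s. b + s *s (a::complex^'n::finite) \<in> S}"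
proof -
  have "continuous_on UNIV (\<lambda>s. b + s *s a)"
    by (intro continuous_intros)
  from open_vimage[OF assms this] show ?thesis by (simp add: vimage_def)
qed

lemma convex_line_preimage:
  assumes "convex S" shows "convex {s. b + s *s (a::complex^'n::finite) \<in> S}"
proof (rule convexI)
  fix s t u v assume *: "s \<in> {s. b + s *s a \<in> S}" "t \<in> {s. b + s *s a \<in> S}"
    and uv: "0 \<le> (u::real)" "0 \<le> v" "u + v = 1"
  have "b + (u *\<^sub>R s + v *\<^sub>R t) *s a = (u + v) *\<^sub>R b + (u *\<^sub>R s + v *\<^sub>R t) *s a"
    by (simp add: uv)
  also have "\<dots> = u *\<^sub>R (b + s *s a) + v *\<^sub>R (b + t *s a)"
    by (simp add: vec_eq_iff vector_scalar_mult_def algebra_simps)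
  also have "\<dots> \<in> S" using convexD[OF assms] * uv by auto
  finally show "u *\<^sub>R s + v *\<^sub>R t \<in> {s. b + s *s a \<in> S}" by simp
qed

lemma complex_diff_on_line:
  assumes "complex_diff_at F (b + s *s a)"
  shows "(\<lambda>s. F (b + s *s a)) field_differentiable at s"
proof -
  obtain D where D: "(F has_derivative D) (at (b + s *s a))" "\<And>c v. D (c *s v) = c * D v"
    using assms unfolding complex_diff_at_def by blast
  have "((\<lambda>s. b + s *s a) has_derivative (\<lambda>u. u *s a)) (at s)"
    by (auto intro!: derivative_eq_intros)
  from has_derivative_compose[OF this D(1)]
  have "((\<lambda>s. F (b + s *s a)) has_derivative (\<lambda>u. u * D a)) (at s)"
    by (simp add: D(2))
  then have "((\<lambda>s. F (b + s *s a)) has_field_derivative D a) (at s)"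
    unfolding has_field_derivative_def fun_eq_iff[of "\<lambda>u. u * D a", THEN iffD2, OF allI, OF mult.commute] .
  then show ?thesis unfolding field_differentiable_def by blast
qed

lemma holomorphic_on_line:
  assumes "\<And>x. x \<in> S \<Longrightarrow> complex_diff_at F x"
  shows "(\<lambda>s. F (b + s *s a)) holomorphic_on {s. b + s *s a \<in> S}"
  unfolding holomorphic_on_def
  using assms complex_diff_on_line field_differentiable_at_within by blast

text \<open>
  The point \<open>y\<close> and a point of \<open>W\<close> are joined by a complex line, which meets the convex set \<open>S\<close> in a
  connected set; on it the one-variable identity theorem applies.
\<close>

lemma identity_principle:
  assumes S: "open S" "convex S" and F: "\<And>x. x \<in> S \<Longrightarrow> complex_diff_at F x"
    and W: "open W" "W \<subseteq> S" "x0 \<in> W" "\<And>x. x \<in> W \<Longrightarrow> F x = 0" and y: "y \<in> S"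
  shows "F y = 0"
proof -
  let ?L = "\<lambda>X. {s. x0 + s *s (y - x0) \<in> X}"
  have "F (x0 + 1 *s (y - x0)) = 0"
  proof (rule analytic_continuation_open[where s="?L W" and s'="?L S" and g="\<lambda>_. 0" and z=1
        and f="\<lambda>s. F (x0 + s *s (y - x0))"])
    show "?L W \<noteq> {}" using W(3) by (auto intro!: exI[of _ 0] simp: vec_eq_iff)
    show "connected (?L S)" by (intro convex_connected convex_line_preimage S)
    show "(\<lambda>s. F (x0 + s *s (y - x0))) holomorphic_on ?L S"
      by (rule holomorphic_on_line) (rule F)
      show "open (?L W)" by (rule open_line_preimage[OF W(1)])
    show "open (?L S)" by (rule open_line_preimage[OF S(1)])
  qed (use S W y in auto)
  then show ?thesis by simp
qed

section \<open>Separately holomorphic functions of two variables\<close>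

text \<open>
  Cauchy's inequality on circles of a fixed radius \<open>r\<close> bounds the change of the derivative when the
  parameter moves from \<open>t0\<close> to \<open>t\<close> by \<open>1 / r\<close> times the supremum of \<open>F t - F t0\<close> on a compact set,
  which is small because \<open>F\<close> is uniformly continuous on compact sets.
\<close>

lemma continuous_on_deriv_parameter:
  fixes F :: "complex \<Rightarrow> complex \<Rightarrow> complex"
  assumes "open S" "open T"
    and cont: "continuous_on (S \<times> T) (\<lambda>(t,z). F t z)"
    and hol: "\<And>t. t \<in> S \<Longrightarrow> F t holomorphic_on T"
  shows "continuous_on (S \<times> T) (\<lambda>(t,z). deriv (F t) z)"
proof (rule continuous_at_imp_continuous_on, clarify)
  fix t0 z0 assume t0: "t0 \<in> S" and z0: "z0 \<in> T"
  obtain r1 where r1: "r1 > 0" "cball t0 r1 \<subseteq> S"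
    using open_contains_cball \<open>open S\<close> t0 by blast
  obtain r2 where r2: "r2 > 0" "cball z0 r2 \<subseteq> T"
    using open_contains_cball \<open>open T\<close> z0 by blast
  \<comment> \<open>Half the radius, so that circles of radius \<open>r\<close> around points within \<open>r\<close> of \<open>z0\<close> stay in \<open>T\<close>.\<close>
  define r where "r = r2 / 2"
  have r: "r > 0" "cball z0 (2 * r) \<subseteq> T" using r2 by (auto simp: r_def)
  let ?K = "cball t0 r1 \<times> cball z0 (2 * r)"
  have "uniformly_continuous_on ?K (\<lambda>(t,z). F t z)"
    using r1 r by (intro compact_uniformly_continuous continuous_on_subset[OF cont])
      (auto intro: compact_Times)
  note uc = this[unfolded uniformly_continuous_on_def, rule_format]
  show "isCont (\<lambda>(t,z). deriv (F t) z) (t0, z0)"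
    unfolding continuous_at_eps_delta
  proof (intro allI impI)
    fix e :: real assume e: "e > 0"
    from uc[of "e * r / 2"] e r(1) obtain d where d: "d > 0"
      "\<And>x x'. x \<in> ?K \<Longrightarrow> x' \<in> ?K \<Longrightarrow> dist x' x < d \<Longrightarrow>
         dist (case x' of (t,z) \<Rightarrow> F t z) (case x of (t,z) \<Rightarrow> F t z) < e * r / 2"
      by (metis divide_pos_pos mult_pos_pos zero_less_numeral)
    have "deriv (F t0) holomorphic_on T"
      using hol[OF t0] \<open>open T\<close> by (rule holomorphic_deriv)
    then have "isCont (deriv (F t0)) z0"
      using \<open>open T\<close> z0 continuous_on_eq_continuous_at holomorphic_on_imp_continuous_on by blast
    then obtain d' where d': "d' > 0"
      "\<And>z. dist z z0 < d' \<Longrightarrow> dist (deriv (F t0) z) (deriv (F t0) z0) < e / 2"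
      unfolding continuous_at_eps_delta using e half_gt_zero by blast
    let ?d = "min (min d r1) (min d' r)"
    show "\<exists>d>0. \<forall>x'. dist x' (t0, z0) < d \<longrightarrow>
       dist (case x' of (t, z) \<Rightarrow> deriv (F t) z) (case (t0, z0) of (t, z) \<Rightarrow> deriv (F t) z) < e"
    proof (intro exI[of _ ?d] conjI allI impI)
      show "?d > 0" using d d' r1 r by simp
      fix x' assume x': "dist x' (t0, z0) < ?d"
      obtain t z where tz: "x' = (t, z)" by fastforce
      have t: "dist t t0 < ?d" and z: "dist z z0 < ?d"
        using x' dist_fst_le[of x' "(t0,z0)"] dist_snd_le[of x' "(t0,z0)"] by (auto simp: tz)
      have tS: "t \<in> S" using t r1 by (auto simp: dist_commute subset_iff)
      have sub: "cball z r \<subseteq> cball z0 (2 * r)"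
        using z r by (simp add: cball_subset_cball_iff)
      have zT: "z \<in> T" using sub r by (auto simp: subset_iff)
      have holz: "(\<lambda>w. F t w - F t0 w) holomorphic_on T"
        by (intro holomorphic_intros hol tS t0)
      have "norm ((deriv ^^ 1) (\<lambda>w. F t w - F t0 w) z) \<le> fact 1 * (e * r / 2) / r ^ 1"
      proof (rule Cauchy_inequality)
        show "(\<lambda>w. F t w - F t0 w) holomorphic_on ball z r"
          using holz by (rule holomorphic_on_subset) (use sub r ball_subset_cball in blast)
        show "continuous_on (cball z r) (\<lambda>w. F t w - F t0 w)"
          by (rule continuous_on_subset[OF holomorphic_on_imp_continuous_on[OF holz]])
             (use sub r in blast)
        fix w assume "norm (z - w) = r"
        then have "w \<in> cball z0 (2 * r)" using sub by (auto simp: subset_iff dist_norm)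
        then have "dist (F t w) (F t0 w) < e * r / 2"
          using d(2)[of "(t0,w)" "(t,w)"] t r1 by (auto simp: dist_Pair_Pair dist_commute)
        then show "norm (F t w - F t0 w) \<le> e * r / 2" by (simp add: dist_norm)
      qed (use r in auto)
      moreover have "deriv (\<lambda>w. F t w - F t0 w) z = deriv (F t) z - deriv (F t0) z"
        using hol[OF tS] hol[OF t0] zT \<open>open T\<close>
        by (intro deriv_diff) (auto simp: holomorphic_on_imp_differentiable_at)
      ultimately have "dist (deriv (F t) z) (deriv (F t0) z) \<le> e / 2"
        using r by (simp add: dist_norm)
      moreover have "dist (deriv (F t0) z) (deriv (F t0) z0) < e / 2"
        using d'(2) z by simp
      ultimately have "dist (deriv (F t) z) (deriv (F t0) z0) < e"
        using dist_triangle[of "deriv (F t) z" "deriv (F t0) z0" "deriv (F t0) z"] by linarith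
      then show "dist (case x' of (t, z) \<Rightarrow> deriv (F t) z)
          (case (t0, z0) of (t, z) \<Rightarrow> deriv (F t) z) < e"
        by (simp add: tz)
    qed
  qed
qed

text \<open>
  Osgood's lemma. A function whose partial derivatives exist and one of whose partial derivatives is
  jointly continuous is differentiable; the joint continuity is \<open>continuous_on_deriv_parameter\<close>.
\<close>

lemma osgood_two_variables:
  fixes F :: "complex \<Rightarrow> complex \<Rightarrow> complex"
  assumes S: "open S" and T: "open T" "convex T"
    and cont: "continuous_on (S \<times> T) (\<lambda>(t,z). F t z)"
    and hol2: "\<And>t. t \<in> S \<Longrightarrow> F t holomorphic_on T"
    and hol1: "\<And>z. z \<in> T \<Longrightarrow> (\<lambda>t. F t z) holomorphic_on S"
    and tz: "t \<in> S" "z \<in> T"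
  shows "((\<lambda>(t,z). F t z) has_derivative
           (\<lambda>(u,v). deriv (\<lambda>t. F t z) t * u + deriv (F t) z * v)) (at (t,z))"
proof -
  have "((\<lambda>(t,z). F t z) has_derivative
     (\<lambda>(u,v). deriv (\<lambda>t. F t z) t * u + blinfun_apply (blinfun_mult_right (deriv (F t) z)) v))
     (at (t,z) within S \<times> T)"
  proof (rule has_derivative_partialsI)
    show "((\<lambda>t. F t z) has_derivative (*) (deriv (\<lambda>t. F t z) t)) (at t within S)"
      using holomorphic_derivI[OF hol1[OF tz(2)] S tz(1)]
      by (simp add: has_field_derivative_def has_derivative_at_withinI)
    show "(F t has_derivative blinfun_apply (blinfun_mult_right (deriv (F t) z))) (at z within T)"
      if "t \<in> S" "z \<in> T" for t z
      using holomorphic_derivI[OF hol2[OF that(1)] T(1) that(2)]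
      by (simp add: has_field_derivative_def has_derivative_at_withinI)
    have "continuous_on (S \<times> T) (\<lambda>x. blinfun_mult_right (case x of (t,z) \<Rightarrow> deriv (F t) z))"
      by (intro bounded_linear.continuous_on[OF bounded_linear_blinfun_mult_right]
          continuous_on_deriv_parameter S T cont hol2)
    then show "continuous (at (t, z) within S \<times> T) (\<lambda>(t, z). blinfun_mult_right (deriv (F t) z))"
      using tz by (simp add: continuous_on_eq_continuous_within case_prod_unfold)
  qed (use tz T in auto)
  then show ?thesis
    using tz S T at_within_open[of "(t,z)" "S \<times> T"] by (simp add: open_Times)
qed

section \<open>Zeros and roots in one variable\<close>

lemma holomorphic_nonzero_nearby:
  assumes "f holomorphic_on S" "open S" "connected S" "\<xi> \<in> S" "\<beta> \<in> S" "f \<beta> \<noteq> 0"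
  shows "\<forall>\<^sub>F z in at \<xi>. f z \<noteq> (0::complex)"
proof (cases "f \<xi> = 0")
  case True
  from isolated_zeros[OF assms(1-4) True assms(5,6)]
  obtain r where "0 < r" "\<And>z. z \<in> ball \<xi> r - {\<xi>} \<Longrightarrow> f z \<noteq> 0" by metis
  then show ?thesis
    unfolding eventually_at by (intro exI[of _ r]) (auto simp: dist_commute)
next
  case False
  have "isCont f \<xi>"
    using assms by (meson continuous_on_eq_continuous_at holomorphic_on_imp_continuous_on)
  then show ?thesis using False tendsto_imp_eventually_ne isContD by blast
qed

text \<open>
  A holomorphic \<open>\<phi>\<close> with a zero of order \<open>\<nu>\<close> at 0 is \<open>k ^ \<nu>\<close> for a holomorphic \<open>k\<close> with a simple zero,
  and \<open>g\<close> is the local inverse of \<open>k\<close>. Injectivity of \<open>g\<close> records that its images of discs are open.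
\<close>

lemma power_normal_form:
  assumes hol: "\<phi> holomorphic_on ball 0 R" and "\<phi> 0 = 0" and w: "w \<in> ball 0 R" "\<phi> w \<noteq> 0"
  obtains \<nu> r and g :: "complex \<Rightarrow> complex" where "0 < \<nu>" "0 < r"
    "g holomorphic_on ball 0 r" "inj_on g (ball 0 r)" "g 0 = 0"
    "\<And>\<sigma>. \<sigma> \<in> ball 0 r \<Longrightarrow> \<phi> (g \<sigma>) = \<sigma> ^ \<nu>"
proof -
  have R: "R > 0" using w(1) by (metis ball_eq_empty empty_iff not_le)
  define \<nu> where "\<nu> = (LEAST n. (deriv ^^ n) \<phi> 0 \<noteq> 0)"
  have "\<exists>n. (deriv ^^ n) \<phi> 0 \<noteq> 0"
    using holomorphic_fun_eq_0_on_ball[OF hol w(1)] w(2) by blast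
  then have \<nu>: "(deriv ^^ \<nu>) \<phi> 0 \<noteq> 0" unfolding \<nu>_def by (rule LeastI_ex)
  have min: "(deriv ^^ i) \<phi> 0 = 0" if "i < \<nu>" for i
    using not_less_Least[OF that[unfolded \<nu>_def]] by simp
  have \<nu>0: "\<nu> > 0" using \<nu> \<open>\<phi> 0 = 0\<close> by (cases \<nu>) auto
  obtain G r1 where G: "0 < r1" "G holomorphic_on ball 0 r1"
    "\<And>w. w \<in> ball 0 r1 \<Longrightarrow> \<phi> w - \<phi> 0 = ((w - 0) * G w) ^ \<nu>"
    "\<And>w. w \<in> ball 0 r1 \<Longrightarrow> G w \<noteq> 0"
    using holomorphic_factor_order_of_zero_strong[OF hol open_ball _ \<nu>0 \<nu>] min R
    by (metis centre_in_ball)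
  define k where "k w = w * G w" for w
  have holk: "k holomorphic_on ball 0 r1"
    unfolding k_def by (intro holomorphic_intros G)
  have "(k has_field_derivative (1 * G 0 + deriv G 0 * 0)) (at 0)"
    unfolding k_def using holomorphic_derivI[OF G(2) open_ball, of 0] G(1)
    by (intro DERIV_mult) auto
  then have dk: "deriv k 0 \<noteq> 0" using G(4)[of 0] G(1) by (auto dest: DERIV_imp_deriv)
  have "(0::complex) \<in> ball 0 r1" using G(1) by simp
  then obtain r2 where r2: "r2 > 0" "ball (0::complex) r2 \<subseteq> ball 0 r1"
    "open (k ` ball 0 r2)" "inj_on k (ball 0 r2)"
    by (rule has_complex_derivative_locally_invertible[OF holk _ open_ball dk])
  have holk2: "k holomorphic_on ball 0 r2" using holk r2(2) by (rule holomorphic_on_subset)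
  obtain g where g: "g holomorphic_on k ` ball 0 r2" "\<And>z. z \<in> ball 0 r2 \<Longrightarrow> g (k z) = z"
    using holomorphic_has_inverse[OF holk2 open_ball r2(4)] by metis
  have "k 0 = 0" by (simp add: k_def)
  then have "0 \<in> k ` ball 0 r2" using r2(1) by (metis centre_in_ball imageI)
  then obtain r where r: "r > 0" "ball 0 r \<subseteq> k ` ball 0 r2"
    using r2(3) open_contains_ball by blast
  show thesis
  proof (rule that[OF \<nu>0 r(1)])
    show "g holomorphic_on ball 0 r" using g(1) r(2) by (rule holomorphic_on_subset)
    show "inj_on g (ball 0 r)"
    proof (rule inj_onI)
      fix a b assume ab: "a \<in> ball 0 r" "b \<in> ball 0 r" "g a = g b"
      obtain a' b' where "a' \<in> ball 0 r2" "a = k a'" "b' \<in> ball 0 r2" "b = k b'"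
        using ab(1,2) r(2) by blast
      then show "a = b" using ab(3) g(2) by metis
    qed
    show "g 0 = 0" using g(2)[of 0] r2(1) \<open>k 0 = 0\<close> by simp
    fix \<sigma> :: complex assume "\<sigma> \<in> ball 0 r"
    then obtain z where z: "z \<in> ball 0 r2" "\<sigma> = k z" using r(2) by blast
    then show "\<phi> (g \<sigma>) = \<sigma> ^ \<nu>" using g(2) G(3)[of z] r2(2) \<open>\<phi> 0 = 0\<close> by (auto simp: k_def)
  qed
qed

lemma local_root_branch:
  fixes t0 \<sigma>0 :: complex
  assumes "0 < \<nu>" "t0 \<noteq> 0" "\<sigma>0 ^ \<nu> = t0"
  obtains b d where "b t0 = \<sigma>0" "(b has_field_derivative d) (at t0)"
    "\<And>t. t \<noteq> 0 \<Longrightarrow> b t ^ \<nu> = t"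
proof -
  let ?b = "\<lambda>t. \<sigma>0 * exp (Ln (t / t0) / of_nat \<nu>)"
  have 1: "?b t0 = \<sigma>0" using assms by simp
  have 2: "(?b has_field_derivative (\<sigma>0 * (inverse t0 / of_nat \<nu>))) (at t0)"
    using assms by (auto intro!: derivative_eq_intros simp: field_simps)
  have 3: "?b t ^ \<nu> = t" if "t \<noteq> 0" for t
    using assms that by (simp add: power_mult_distrib exp_of_nat_mult[symmetric])
  show thesis by (rule that[OF 1 2 3])
qed

text \<open>
  Two \<open>\<nu>\<close>-th roots of the same number differ by a root of unity, and multiplication by it permutes the
  roots of unity. This makes the product over all branches independent of the chosen branch.
\<close>

lemma prod_roots_of_unity_shift:
  fixes E :: "complex \<Rightarrow> complex"
  assumes "0 < \<nu>" "\<sigma> ^ \<nu> = \<tau> ^ \<nu>"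
  shows "(\<Prod>w | w ^ \<nu> = 1. E (w * \<sigma>)) = (\<Prod>w | w ^ \<nu> = 1. E (w * \<tau>))"
proof (cases "\<tau> = 0")
  case True
  moreover from this have "\<sigma> = 0" using assms by (auto simp: power_0_left)
  ultimately show ?thesis by simp
next
  case False
  then have "\<sigma> \<noteq> 0" using assms by (auto simp: power_0_left)
  show ?thesis
  proof (rule prod.reindex_bij_witness[where i="\<lambda>w. w * \<tau> / \<sigma>" and j="\<lambda>w. w * \<sigma> / \<tau>"])
  qed (use assms False \<open>\<sigma> \<noteq> 0\<close> in \<open>auto simp: power_mult_distrib power_divide\<close>)
qed

section \<open>Coordinates and the two one-forms\<close>

definition point2 :: "complex \<Rightarrow> complex \<Rightarrow> complex^2" where
  "point2 t z = t *s axis 1 1 + z *s axis 2 1"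

lemma point2_nth [simp]:
  "vec_nth (point2 t z) 1 = t" "vec_nth (point2 t z) 2 = z"
  by (simp_all add: point2_def axis_def)

lemma point2_eta: "point2 (vec_nth q 1) (vec_nth q 2) = q"
  by (simp add: vec_eq_iff forall_2)

lemma scale_point2: "c *s point2 t z = point2 (c * t) (c * z)"
  by (simp add: vec_eq_iff forall_2)

lemma has_derivative_point2 [derivative_intros]:
  assumes "(f has_derivative f') F" "(g has_derivative g') F"
  shows "((\<lambda>x. point2 (f x) (g x)) has_derivative (\<lambda>u. point2 (f' u) (g' u))) F"
  unfolding point2_def by (intro derivative_intros assms)

definition lift_x :: "complex^'m::finite \<Rightarrow> complex^('m option)" where
  "lift_x v = (\<chi> i. case i of Some j \<Rightarrow> vec_nth v j | None \<Rightarrow> 0)"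

lemma coord_simps [simp]:
  "x_coord (lift_x v) = v" "z_coord (lift_x v) = 0"
  "x_coord (axis None 1 :: complex^('m::finite option)) = 0" "z_coord (axis None 1) = 1"
  "x_coord (q + q') = x_coord q + x_coord q'" "z_coord (q + q') = z_coord q + z_coord q'"
  "x_coord (c *s q) = c *s x_coord q" "z_coord (c *s q) = c * z_coord q"
  "x_coord 0 = 0" "z_coord 0 = 0"
  by (simp_all add: x_coord_def z_coord_def lift_x_def axis_def vec_eq_iff)

lemma coordinates_scaled:
  "s *s lift_x (x_coord q) + (s * z_coord q) *s axis None 1 = s *s q"
  by (simp add: vec_eq_iff lift_x_def x_coord_def z_coord_def axis_def split: option.split)

lemma norm_x_coord_le: "norm (x_coord q) \<le> norm (q :: complex^('m::finite option))"
proof -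
  have "(\<Sum>i\<in>UNIV. (norm (vec_nth q (Some i)))\<^sup>2) = (\<Sum>i\<in>range Some. (norm (vec_nth q i))\<^sup>2)"
    by (subst sum.reindex) auto
  also have "\<dots> \<le> (\<Sum>i\<in>UNIV. (norm (vec_nth q i))\<^sup>2)" by (intro sum_mono2) auto
  finally show ?thesis unfolding x_coord_def norm_vec_def L2_set_def by simp
qed

lemma norm_lift_x: "norm (lift_x v) = norm (v :: complex^'m::finite)"
proof -
  have "(\<Sum>i\<in>UNIV. (norm (vec_nth (lift_x v) i))\<^sup>2) = (\<Sum>i\<in>range Some. (norm (vec_nth (lift_x v) i))\<^sup>2)"
    by (simp add: UNIV_option_conv lift_x_def)
  also have "\<dots> = (\<Sum>i\<in>UNIV. (norm (vec_nth v i))\<^sup>2)" 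
    by (subst sum.reindex) (auto simp: lift_x_def)
  finally show ?thesis unfolding norm_vec_def L2_set_def by simp
qed

lemma bounded_linear_x_coord: "bounded_linear (x_coord :: complex^('m::finite option) \<Rightarrow> _)"
  by (intro linear_conv_bounded_linear[THEN iffD1] linearI) (auto simp: x_coord_def vec_eq_iff)

lemma bounded_linear_z_coord: "bounded_linear (z_coord :: complex^('m::finite option) \<Rightarrow> _)"
  unfolding z_coord_def by (rule bounded_linear_vec_nth)

lemmas has_derivative_x_coord = bounded_linear.has_derivative[OF bounded_linear_x_coord]
lemmas has_derivative_z_coord = bounded_linear.has_derivative[OF bounded_linear_z_coord]
lemmas has_derivative_vec_nth = bounded_linear.has_derivative[OF bounded_linear_vec_nth]

lemma ext_d_eq: "(h has_derivative D) (at x) \<Longrightarrow> ext_d h x = D"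
  unfolding ext_d_def using frechet_derivative_at by fastforce

lemma omega_form_eq:
  "omega_form n p \<alpha> U q u =
     of_nat n * vec_nth q 1 ^ (n - 1) * vec_nth u 1 +
     (2 * vec_nth q 2 + \<alpha> * vec_nth q 1 ^ p * eval_fps U (vec_nth q 1)) * vec_nth u 2"
proof -
  have "((\<lambda>q::complex^2. (vec_nth q 2)\<^sup>2 + vec_nth q 1 ^ n) has_derivative
     (\<lambda>u. of_nat 2 * vec_nth u 2 * vec_nth q 2 ^ (2 - 1) + of_nat n * vec_nth u 1 * vec_nth q 1 ^ (n - 1))) (at q)"
    by (intro has_derivative_add has_derivative_power has_derivative_vec_nth has_derivative_ident)
  note this[THEN ext_d_eq]
  moreover have "((\<lambda>q::complex^2. vec_nth q 2) has_derivative (\<lambda>u. vec_nth u 2)) (at q)"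
    by (intro has_derivative_vec_nth has_derivative_ident)
  note this[THEN ext_d_eq]
  ultimately show ?thesis unfolding omega_form_def by (simp add: algebra_simps)
qed

text \<open>
  The identity \<open>\<Omega> = \<Phi>\<^sup>* \<omega>\<close>: the arguments of \<open>\<omega>\<close> on the right are \<open>\<Phi> q\<close> and the image of
  the tangent vector \<open>u\<close> under the derivative of \<open>\<Phi>\<close> at \<open>q\<close>.
\<close>

lemma Omega_form_eq_pullback:
  assumes D: "(f has_derivative D) (at (x_coord q))"
  shows "Omega_form f n p \<alpha> U q u =
    omega_form n p \<alpha> U (point2 (f (x_coord q)) (z_coord q)) (point2 (D (x_coord u)) (z_coord u))"
proof -
  have "((\<lambda>q. f (x_coord q)) has_derivative (\<lambda>u. D (x_coord u))) (at q)"
    using has_derivative_compose[OF has_derivative_x_coord[OF has_derivative_ident] D] .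
  then have "((\<lambda>q. z_coord q ^ 2 + f (x_coord q) ^ n) has_derivative
     (\<lambda>u. of_nat 2 * z_coord u * z_coord q ^ (2 - 1) + of_nat n * D (x_coord u) * f (x_coord q) ^ (n - 1))) (at q)"
    by (intro has_derivative_add has_derivative_power has_derivative_z_coord has_derivative_ident)
  note this[THEN ext_d_eq]
  moreover have "(z_coord has_derivative z_coord) (at q)"
    by (intro has_derivative_z_coord has_derivative_ident)
  note this[THEN ext_d_eq]
  ultimately show ?thesis unfolding Omega_form_def omega_form_eq by (simp add: algebra_simps)
qed

section \<open>First integrals across a coordinate line\<close>

text \<open>
  In two variables, \<open>dH \<and> \<eta> = 0\<close> is the single equation \<open>H\<^sub>t B = H\<^sub>z A\<close>. Both sides are continuous in
  \<open>t\<close> once \<open>H\<close> is known to be holomorphic in \<open>t\<close> at 0 (a removable singularity) and \<open>H\<^sub>z\<close> to be jointly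
  continuous, so the equation persists at \<open>t = 0\<close>; Osgood's lemma supplies the total derivative there.
\<close>

lemma first_integral_extends_across_line:
  fixes H :: "complex \<Rightarrow> complex \<Rightarrow> complex"
  assumes S: "open S" and T: "open T" "convex T"
    and cont: "continuous_on (S \<times> T) (\<lambda>(t,z). H t z)"
    and hol: "\<And>t. t \<in> S \<Longrightarrow> H t holomorphic_on T"
    and \<eta>: "\<And>t z u. \<eta> (point2 t z) u = A t z * vec_nth u 1 + B t z * vec_nth u 2"
    and A: "\<And>z. z \<in> T \<Longrightarrow> continuous_on S (\<lambda>t. A t z)"
    and B: "\<And>z. z \<in> T \<Longrightarrow> continuous_on S (\<lambda>t. B t z)"
    and off: "\<And>t z. t \<in> S \<Longrightarrow> z \<in> T \<Longrightarrow> t \<noteq> 0 \<Longrightarrow>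
       first_integral_at \<eta> (\<lambda>q. H (vec_nth q 1) (vec_nth q 2)) (point2 t z)"
    and tz: "t \<in> S" "z \<in> T"
  shows "first_integral_at \<eta> (\<lambda>q. H (vec_nth q 1) (vec_nth q 2)) (point2 t z)"
proof -
  let ?H = "\<lambda>q::complex^2. H (vec_nth q 1) (vec_nth q 2)"
  have hol1: "(\<lambda>t. H t z) holomorphic_on S" if z: "z \<in> T" for z
  proof (rule no_isolated_singularity[where K="{0}"])
    have "continuous_on S ((\<lambda>(t,z). H t z) \<circ> (\<lambda>t. (t,z)))"
      using z by (intro continuous_on_compose continuous_intros continuous_on_subset[OF cont]) auto
    then show "continuous_on S (\<lambda>t. H t z)" by (simp add: o_def)
    have "(\<lambda>t. H t z) field_differentiable at t" if "t \<in> S - {0}" for t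
    proof -
      have "complex_diff_at ?H (z *s axis 2 1 + t *s axis 1 1)"
        using off[of t z] that z
        by (auto simp: point2_def add.commute intro: first_integral_at_imp_complex_diff)
      from complex_diff_on_line[OF this] show ?thesis by (simp add: axis_def)
    qed
    then show "(\<lambda>t. H t z) holomorphic_on S - {0}"
      unfolding holomorphic_on_def using field_differentiable_at_within by blast
  qed (use S in auto)
  define a where "a t z = deriv (\<lambda>t. H t z) t" for t z
  define b where "b t z = deriv (H t) z" for t z
  have der: "(?H has_derivative (\<lambda>u. a t z * vec_nth u 1 + b t z * vec_nth u 2)) (at (point2 t z))"
    if "t \<in> S" "z \<in> T" for t z
  proof -
    have 1: "((\<lambda>q::complex^2. (vec_nth q 1, vec_nth q 2)) has_derivative
           (\<lambda>u. (vec_nth u 1, vec_nth u 2))) (at (point2 t z))"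
      by (intro has_derivative_Pair has_derivative_vec_nth has_derivative_ident)
    have 2: "((\<lambda>(t,z). H t z) has_derivative (\<lambda>(u,v). a t z * u + b t z * v))
       (at (vec_nth (point2 t z) 1, vec_nth (point2 t z) 2))"
      using osgood_two_variables[OF S T cont hol hol1 that] by (simp add: a_def b_def)
    show ?thesis using has_derivative_compose[OF 1 2] by simp
  qed
  have rel: "a t z * B t z = b t z * A t z" if tz': "t \<in> S" "z \<in> T" "t \<noteq> 0" for t z
  proof -
    obtain D where D: "(?H has_derivative D) (at (point2 t z))"
      "\<And>u v. D u * \<eta> (point2 t z) v = D v * \<eta> (point2 t z) u"
      using off[OF tz'] unfolding first_integral_at_def by blast
    have "D = (\<lambda>u. a t z * vec_nth u 1 + b t z * vec_nth u 2)"
      using has_derivative_unique[OF D(1) der] tz' by blast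
    with D(2)[of "point2 1 0" "point2 0 1"] show ?thesis by (simp add: \<eta>)
  qed
  have rel': "a t z * B t z = b t z * A t z"
  proof (cases "t = 0")
    case False then show ?thesis using rel tz by blast
  next
    case True
    let ?f = "\<lambda>t. a t z * B t z - b t z * A t z"
    have "continuous_on S ((\<lambda>(t,z). b t z) \<circ> (\<lambda>t. (t,z)))"
      unfolding b_def using tz
      by (intro continuous_on_compose continuous_intros
          continuous_on_subset[OF continuous_on_deriv_parameter[OF S T(1) cont hol]]) auto
    then have "continuous_on S (\<lambda>t. b t z)" by (simp add: o_def)
    moreover have "continuous_on S (\<lambda>t. a t z)"
      unfolding a_def using holomorphic_deriv[OF hol1[OF tz(2)] S] holomorphic_on_imp_continuous_on
      by blast
    ultimately have "continuous_on S ?f"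
      using A B tz by (intro continuous_intros) auto
    then have "(?f \<longlongrightarrow> ?f t) (at t)"
      using S tz continuous_on_eq_continuous_at isContD by blast
    moreover have "\<forall>\<^sub>F s in at t. ?f s = 0"
      using eventually_at_in_open'[OF S tz(1)] eventually_at_in_open[OF S tz(1)]
      by eventually_elim (use rel tz True in auto)
    then have "(?f \<longlongrightarrow> 0) (at t)" by (rule tendsto_eventually)
    ultimately have "?f t = 0" using tendsto_unique trivial_limit_at by blast
    then show ?thesis by simp
  qed
  show ?thesis unfolding first_integral_at_def
  proof (intro exI conjI allI)
    show "(?H has_derivative (\<lambda>u. a t z * vec_nth u 1 + b t z * vec_nth u 2)) (at (point2 t z))"
      by (rule der[OF tz])
    fix u v :: "complex^2"
    have "(a t z * vec_nth u 1 + b t z * vec_nth u 2) * \<eta> (point2 t z) v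
      - (a t z * vec_nth v 1 + b t z * vec_nth v 2) * \<eta> (point2 t z) u
      = (a t z * B t z - b t z * A t z) * (vec_nth u 1 * vec_nth v 2 - vec_nth u 2 * vec_nth v 1)"
      unfolding \<eta> by (simp add: algebra_simps)
    then show "(a t z * vec_nth u 1 + b t z * vec_nth u 2) * \<eta> (point2 t z) v
      = (a t z * vec_nth v 1 + b t z * vec_nth v 2) * \<eta> (point2 t z) u"
      using rel' by simp
  qed (simp add: algebra_simps)
qed

section \<open>Pulling first integrals back\<close>

lemma germ_nonzero:
  assumes "holomorphic_at_0 f" "hgerm_of f \<noteq> 0"
  shows "\<not> (\<forall>\<^sub>F x in nhds 0. f x = 0)"
proof
  assume "\<forall>\<^sub>F x in nhds 0. f x = 0"
  then have "germ_rel f (\<lambda>_. 0)"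
    using assms(1) holomorphic_at_0_const by (simp add: germ_rel_def)
  then have "hgerm_of f = hgerm_of (\<lambda>_. 0)"
    using Quotient_rel_abs[OF Quotient_hgerm] by blast
  then show False using assms(2) by (simp add: zero_hgerm_def)
qed

lemma eventually_nhds_ball:
  "(\<forall>\<^sub>F x in nhds a. P x) \<longleftrightarrow> (\<exists>e>0. \<forall>x\<in>ball a e. P x)" for a :: "'a::metric_space"
  by (auto simp: eventually_nhds_metric dist_commute)

text \<open>
  A complex line through 0 and a point where \<open>f\<close> does not vanish reduces this to the open mapping
  theorem in one variable.
\<close>

lemma germ_image_neighbourhood:
  assumes f: "\<And>x. x \<in> ball 0 e0 \<Longrightarrow> complex_diff_at f x" "e0 > 0" "f 0 = 0"
    and nz: "\<not> (\<forall>\<^sub>F x in nhds 0. f x = 0)" and e: "e > 0"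
  shows "\<exists>d>0. ball 0 d \<subseteq> f ` ball (0::complex^'m::finite) e"
proof -
  define e1 where "e1 = min e e0"
  have e1: "e1 > 0" using f(2) e by (simp add: e1_def)
  obtain v where v: "v \<in> ball 0 e1" "f v \<noteq> 0"
    using nz e1 unfolding eventually_nhds_ball by blast
  let ?S = "{s. 0 + s *s v \<in> ball 0 e1}" and ?\<phi> = "\<lambda>s. f (0 + s *s v)"
  have "open (?\<phi> ` ?S)"
  proof (rule open_mapping_thm[where S="?S"])
    show "?\<phi> holomorphic_on ?S" by (rule holomorphic_on_line) (use f in \<open>auto simp: e1_def\<close>)
    show "open ?S" "open ?S" by (rule open_line_preimage[OF open_ball])+
    show "connected ?S" by (intro convex_connected convex_line_preimage convex_ball)
    show "\<not> ?\<phi> constant_on ?S"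
    proof
      assume "?\<phi> constant_on ?S"
      then obtain c where "\<And>s. s \<in> ?S \<Longrightarrow> ?\<phi> s = c" unfolding constant_on_def by blast
      from this[of 0] this[of 1] show False using v f e1 by simp
    qed
  qed auto
  moreover have "0 \<in> ?\<phi> ` ?S" using f(3) e1 by (intro image_eqI[of _ _ 0]) auto
  ultimately obtain d where "d > 0" "ball 0 d \<subseteq> ?\<phi> ` ?S" using open_contains_ball by blast
  moreover have "?\<phi> ` ?S \<subseteq> f ` ball 0 e" by (auto simp: e1_def)
  ultimately show ?thesis by blast
qed

text \<open>
  Nonconstancy holds because \<open>\<Phi>\<close> is locally onto: if \<open>H \<circ> \<Phi>\<close> were constant near the origin, then \<open>H\<close>
  would be constant on the image, which is a neighbourhood of the origin.
\<close>

lemma first_integral_pullback_by_germ: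
  fixes f :: "complex^'m::finite \<Rightarrow> complex"
  assumes f: "holomorphic_at_0 f" "f 0 = 0" "\<not> (\<forall>\<^sub>F x in nhds 0. f x = 0)"
    and H: "holomorphic_first_integral (omega_form n p \<alpha> U) H"
  shows "holomorphic_first_integral (Omega_form f n p \<alpha> U)
           (\<lambda>q. H (point2 (f (x_coord q)) (z_coord q)))"
proof -
  let ?\<Phi> = "\<lambda>q. point2 (f (x_coord q)) (z_coord q)"
  have "\<forall>\<^sub>F x in nhds 0. complex_diff_at f x"
    using f(1) unfolding holomorphic_at_0_def complex_diff_at_def .
  then obtain e where e: "e > 0" "\<And>x. x \<in> ball 0 e \<Longrightarrow> complex_diff_at f x"
    unfolding eventually_nhds_ball by blast
  have Hint: "\<forall>\<^sub>F y in nhds 0. first_integral_at (omega_form n p \<alpha> U) H y"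
    and Hnc: "\<not> (\<forall>\<^sub>F y in nhds 0. H y = H 0)"
    using H unfolding holomorphic_first_integral_iff by blast+
  have \<Phi>der: "(?\<Phi> has_derivative (\<lambda>u. point2 (D (x_coord u)) (z_coord u))) (at q)"
    if "(f has_derivative D) (at (x_coord q))" for D q
    by (intro has_derivative_point2 has_derivative_z_coord has_derivative_ident
        has_derivative_compose[OF has_derivative_x_coord[OF has_derivative_ident] that])
  have \<Phi>0: "?\<Phi> 0 = 0" using f(2) by (simp add: point2_def)
  have "isCont ?\<Phi> 0"
    using \<Phi>der[of _ 0] e(2)[of 0] e(1) has_derivative_continuous unfolding complex_diff_at_def by force
  then have lim: "(?\<Phi> \<longlongrightarrow> 0) (nhds 0)"
    using \<Phi>0 by (simp add: tendsto_nhds_iff isCont_def)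
  have xlim: "(x_coord \<longlongrightarrow> 0) (nhds (0::complex^('m option)))"
    using bounded_linear.isCont[OF bounded_linear_x_coord continuous_ident, of 0]
    by (simp add: tendsto_nhds_iff isCont_def)
  have "\<forall>\<^sub>F q in nhds 0. first_integral_at (Omega_form f n p \<alpha> U) (\<lambda>q. H (?\<Phi> q)) q"
  proof -
    have "\<forall>\<^sub>F q in nhds 0. first_integral_at (omega_form n p \<alpha> U) H (?\<Phi> q)"
      using Hint lim by (auto simp: filterlim_iff)
    moreover have "\<forall>\<^sub>F q in nhds (0::complex^('m option)). x_coord q \<in> ball 0 e"
      using xlim e(1) by (metis centre_in_ball open_ball topological_tendstoD)
    ultimately show ?thesis
    proof eventually_elim
      case (elim q)
      then obtain D where D: "(f has_derivative D) (at (x_coord q))" "\<And>c v. D (c *s v) = c * D v"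
        using e(2) unfolding complex_diff_at_def by blast
      show ?case
      proof (rule first_integral_at_pullback[OF elim(1) \<Phi>der[OF D(1)]])
        show "omega_form n p \<alpha> U (?\<Phi> q) (point2 (D (x_coord u)) (z_coord u)) = Omega_form f n p \<alpha> U q u"
          for u using Omega_form_eq_pullback[OF D(1)] by simp
      qed (simp add: D(2) scale_point2)
    qed
  qed
  moreover have "\<not> (\<forall>\<^sub>F q in nhds 0. H (?\<Phi> q) = H (?\<Phi> 0))"
  proof
    assume "\<forall>\<^sub>F q in nhds 0. H (?\<Phi> q) = H (?\<Phi> 0)"
    then obtain r where r: "r > 0" "\<And>q. q \<in> ball 0 r \<Longrightarrow> H (?\<Phi> q) = H 0"
      unfolding eventually_nhds_ball \<Phi>0 by blast
    obtain d where d: "d > 0" "ball 0 d \<subseteq> f ` ball 0 (r / 2)"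
      using germ_image_neighbourhood[OF e(2,1) f(2,3) half_gt_zero[OF r(1)]] by blast
    have "\<forall>y\<in>ball 0 (min d (r / 2)). H y = H 0"
    proof
      fix y :: "complex^2" assume y: "y \<in> ball 0 (min d (r / 2))"
      have n: "norm (vec_nth y 1) < d" "norm (vec_nth y 2) < r / 2"
        using y Finite_Cartesian_Product.norm_nth_le[of y 1] Finite_Cartesian_Product.norm_nth_le[of y 2] by auto
      then obtain x where x: "x \<in> ball 0 (r / 2)" "f x = vec_nth y 1" using d(2) by (force simp: image_iff)
      let ?q = "lift_x x + vec_nth y 2 *s axis None 1 :: complex^('m option)"
      have "norm ?q \<le> norm (lift_x x :: complex^('m option)) + norm (vec_nth y 2)"
        using norm_triangle_ineq[of "lift_x x" "vec_nth y 2 *s axis None 1"]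
        by (simp add: norm_scalar_mult)
      then have "?q \<in> ball 0 r" using x(1) n by (simp add: norm_lift_x)
      moreover have "?\<Phi> ?q = y" using x(2) by (simp add: point2_eta)
      ultimately show "H y = H 0" using r(2) by metis
    qed
    then show False using Hnc d(1) r(1) unfolding eventually_nhds_ball
      by (meson half_gt_zero min_less_iff_conj)
  qed
  ultimately show ?thesis unfolding holomorphic_first_integral_iff by blast
qed

section \<open>Descending first integrals\<close>

text \<open>
  Here \<open>\<Psi>(t, z) = (s(t) v, z)\<close> satisfies \<open>\<Phi> \<circ> \<Psi> = id\<close>, so \<open>\<Psi>\<^sup>* \<Omega> = \<Psi>\<^sup>* \<Phi>\<^sup>* \<omega> = \<omega>\<close>.
\<close>

lemma first_integral_at_section:
  fixes s :: "complex \<Rightarrow> complex" and v :: "complex^'m::finite"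
  assumes f: "complex_diff_at f (s t0 *s v)"
    and s: "(s has_field_derivative d) (at t0)"
    and fs: "\<forall>\<^sub>F t in nhds t0. f (s t *s v) = t"
    and h: "first_integral_at (Omega_form f n p \<alpha> U) h (s t0 *s lift_x v + z0 *s axis None 1)"
  shows "first_integral_at (omega_form n p \<alpha> U)
     (\<lambda>q. h (s (vec_nth q 1) *s lift_x v + vec_nth q 2 *s axis None 1)) (point2 t0 z0)"
proof -
  let ?\<Psi> = "\<lambda>q::complex^2. s (vec_nth q 1) *s lift_x v + vec_nth q 2 *s axis None 1"
  let ?P = "\<lambda>u::complex^2. (d * vec_nth u 1) *s lift_x v + vec_nth u 2 *s axis None 1"
  obtain D where D: "(f has_derivative D) (at (s t0 *s v))" "\<And>c v. D (c *s v) = c * D v"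
    using f unfolding complex_diff_at_def by blast
  have s': "(s has_derivative (\<lambda>u. d * u)) (at t0)"
    using s by (simp add: has_field_derivative_def)
  have "((\<lambda>t. f (s t *s v)) has_derivative (\<lambda>u. D ((d * u) *s v))) (at t0)"
    by (rule has_derivative_compose[OF has_derivative_scalar_mult[OF s'] D(1)])
  moreover have "((\<lambda>t. f (s t *s v)) has_derivative (\<lambda>u. u)) (at t0)"
  proof -
    obtain X where X: "open X" "t0 \<in> X" "\<And>t. t \<in> X \<Longrightarrow> f (s t *s v) = t"
      using fs unfolding eventually_nhds by blast
    show ?thesis
      by (rule has_derivative_transform_within_open[OF has_derivative_ident X(1,2)]) (simp add: X(3))
  qed
  ultimately have "(\<lambda>u. D ((d * u) *s v)) = (\<lambda>u. u)" by (rule has_derivative_unique)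
  then have dD: "D ((d * u) *s v) = u" for u by (rule fun_cong)
  have f0: "f (s t0 *s v) = t0" using fs by (rule eventually_nhds_x_imp_x)
  have "((\<lambda>q::complex^2. s (vec_nth q 1)) has_derivative (\<lambda>u. d * vec_nth u 1)) (at (point2 t0 z0))"
  proof (rule has_derivative_compose[where g=s and g'="\<lambda>u. d * u"])
    show "((\<lambda>q::complex^2. vec_nth q 1) has_derivative (\<lambda>u. vec_nth u 1)) (at (point2 t0 z0))"
      by (intro has_derivative_vec_nth has_derivative_ident)
  qed (use s' in simp)
  then have \<Psi>: "(?\<Psi> has_derivative ?P) (at (point2 t0 z0))"
    by (intro has_derivative_add has_derivative_scalar_mult has_derivative_vec_nth has_derivative_ident)
  show ?thesis
  proof (rule first_integral_at_pullback[OF _ \<Psi>])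
    show "first_integral_at (Omega_form f n p \<alpha> U) h (?\<Psi> (point2 t0 z0))" using h by simp
    show "?P (c *s u) = c *s ?P u" for c u
      by (simp add: vec_eq_iff algebra_simps)
    show "Omega_form f n p \<alpha> U (?\<Psi> (point2 t0 z0)) (?P u) = omega_form n p \<alpha> U (point2 t0 z0) u" for u
    proof -
      have "(f has_derivative D) (at (x_coord (?\<Psi> (point2 t0 z0))))" using D(1) by simp
      from Omega_form_eq_pullback[OF this] show ?thesis
        using f0 dD by (simp add: point2_eta)
    qed
  qed
qed

text \<open>
  Points with \<open>h q \<noteq> h 0\<close> form a nonempty open set, and by the identity principle \<open>f\<close> cannot vanish on
  all of it. The first condition will keep the descended first integral from being constant, the second
  makes \<open>f\<close> a nonzero function on the line through the \<open>x\<close>-part of \<open>q\<close>.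
\<close>

lemma exists_generic_point:
  fixes f :: "complex^'m::finite \<Rightarrow> complex"
  assumes f: "\<And>x. x \<in> ball 0 e \<Longrightarrow> complex_diff_at f x" "\<not> (\<forall>\<^sub>F x in nhds 0. f x = 0)"
    and h: "\<And>q. q \<in> ball 0 e \<Longrightarrow> isCont h q" "\<not> (\<forall>\<^sub>F q in nhds 0. h q = (h 0 :: complex))"
    and e: "e > 0"
  obtains q where "q \<in> ball (0::complex^('m option)) e" "h q \<noteq> h 0" "f (x_coord q) \<noteq> 0"
proof (rule ccontr)
  assume "\<not> thesis"
  with that have *: "f (x_coord q) = 0" if "q \<in> ball 0 e" "h q \<noteq> h 0" for q using that by blast
  let ?W = "{q \<in> ball 0 e. h q \<noteq> h 0}"
  obtain q1 where q1: "q1 \<in> ?W" using h(2) e unfolding eventually_nhds_ball by blast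
  have "open ?W"
  proof -
    have "continuous_on (ball 0 e) h" using h(1) continuous_at_imp_continuous_on by blast
    from continuous_open_preimage[OF this open_ball, of "- {h 0}"]
    have "open (ball 0 e \<inter> h -` (- {h 0}))" by (simp add: open_Compl)
    moreover have "ball 0 e \<inter> h -` (- {h 0}) = ?W" by auto
    ultimately show ?thesis by simp
  qed
  have cd: "complex_diff_at (\<lambda>q. f (x_coord q)) q" if "q \<in> ball 0 e" for q :: "complex^('m option)"
  proof -
    have "x_coord q \<in> ball 0 e" using that norm_x_coord_le[of q] by simp
    then obtain D where D: "(f has_derivative D) (at (x_coord q))" "\<And>c v. D (c *s v) = c * D v"
      using f(1) unfolding complex_diff_at_def by blast
    have "((\<lambda>q. f (x_coord q)) has_derivative (\<lambda>u. D (x_coord u))) (at q)"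
      using has_derivative_compose[OF has_derivative_x_coord[OF has_derivative_ident] D(1)] .
    then show ?thesis unfolding complex_diff_at_def using D(2) by (intro exI[of _ "\<lambda>u. D (x_coord u)"]) simp
  qed
  have z: "f (x_coord q) = 0" if "q \<in> ball 0 e" for q :: "complex^('m option)"
    using identity_principle[OF open_ball convex_ball cd \<open>open ?W\<close> _ q1 _ that] * by blast
  have "f x = 0" if "x \<in> ball 0 e" for x
    using z[of "lift_x x"] that by (simp add: norm_lift_x)
  then have "\<forall>\<^sub>F x in nhds 0. f x = 0"
    unfolding eventually_nhds_ball using e by blast
  then show False using f(2) by blast
qed

text \<open>
  The function \<open>H\<close> below is the norm of \<open>h - h 0\<close>, restricted to the plane of points \<open>(s v, z)\<close>, along the
  ramified covering \<open>\<sigma> \<mapsto> \<sigma> ^ \<nu>\<close>.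
\<close>

lemma first_integral_descends:
  fixes f :: "complex^'m::finite \<Rightarrow> complex" and h :: "complex^('m option) \<Rightarrow> complex"
  assumes U: "fps_conv_radius U > 0" and e: "e > 0"
    and f: "\<And>x. x \<in> ball 0 e \<Longrightarrow> complex_diff_at f x" "f 0 = 0"
    and h: "\<And>q. q \<in> ball 0 e \<Longrightarrow> first_integral_at (Omega_form f n p \<alpha> U) h q"
    and q0: "q0 \<in> ball 0 e" "h q0 \<noteq> h 0" "f (x_coord q0) \<noteq> 0"
  shows "\<exists>H. holomorphic_first_integral (omega_form n p \<alpha> U) H"
proof -
  define v where "v = x_coord q0"
  define pt :: "complex \<Rightarrow> complex \<Rightarrow> complex^('m option)" where
    "pt s z = s *s lift_x v + z *s axis None 1" for s z
  have hcd: "complex_diff_at h q" if "q \<in> ball 0 e" for q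
    using h[OF that] by (rule first_integral_at_imp_complex_diff)
  have v: "v \<in> ball 0 e" "f v \<noteq> 0" using q0 norm_x_coord_le[of q0] by (auto simp: v_def)
  then have nv: "norm v > 0" using f(2) by auto
  have npt: "norm (pt s z) \<le> norm s * norm v + norm z" for s z
    using norm_triangle_ineq[of "s *s lift_x v" "z *s axis None 1"]
    by (simp add: pt_def norm_scalar_mult norm_lift_x)
  let ?R = "e / norm v"
  have "(\<lambda>s. f (0 + s *s v)) holomorphic_on {s. 0 + s *s v \<in> ball 0 e}"
    by (rule holomorphic_on_line) (rule f)
  moreover have "{s. 0 + s *s v \<in> ball 0 e} = ball 0 ?R"
    using nv by (auto simp: norm_scalar_mult pos_less_divide_eq)
  ultimately have hol\<phi>: "(\<lambda>s. f (s *s v)) holomorphic_on ball 0 ?R" by simp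
  have one: "1 \<in> ball (0::complex) ?R" using v nv by simp
  define \<phi> where "\<phi> s = f (s *s v)" for s
  have "\<phi> holomorphic_on ball 0 ?R" "\<phi> 0 = 0" "\<phi> 1 \<noteq> 0"
    using hol\<phi> v(2) f(2) by (simp_all add: \<phi>_def[abs_def])
  then obtain \<nu> r and g :: "complex \<Rightarrow> complex" where \<nu>: "0 < \<nu>" and r: "0 < r"
    and g: "g holomorphic_on ball 0 r" "inj_on g (ball 0 r)" "g 0 = 0"
    "\<And>\<sigma>. \<sigma> \<in> ball 0 r \<Longrightarrow> \<phi> (g \<sigma>) = \<sigma> ^ \<nu>"
    using power_normal_form[OF _ _ one] by metis
  have fg: "f (g \<sigma> *s v) = \<sigma> ^ \<nu>" if "\<sigma> \<in> ball 0 r" for \<sigma>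
    using g(4)[OF that] by (simp add: \<phi>_def)
  define T where "T = ball (0::complex) (e / 2)"
  have g_lim: "isCont g 0"
    using g(1) r by (meson centre_in_ball continuous_on_eq_continuous_at holomorphic_on_imp_continuous_on open_ball)
  then obtain \<rho>0 where \<rho>0: "\<rho>0 > 0" "\<And>\<sigma>. dist \<sigma> 0 < \<rho>0 \<Longrightarrow> dist (g \<sigma>) (g 0) < e / (2 * norm v)"
    unfolding continuous_at_eps_delta using e nv by (metis divide_pos_pos mult_pos_pos zero_less_numeral)
  define \<rho> where "\<rho> = min r \<rho>0"
  have \<rho>: "\<rho> > 0" "\<rho> \<le> r" using r \<rho>0 by (auto simp: \<rho>_def)
  have pt_in: "pt (g \<sigma>) z \<in> ball 0 e" if "\<sigma> \<in> ball 0 \<rho>" "z \<in> T" for \<sigma> z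
  proof -
    have "norm (g \<sigma>) < e / (2 * norm v)" using \<rho>0(2)[of \<sigma>] that g(3) by (simp add: \<rho>_def)
    then have "norm (g \<sigma>) * norm v < e / 2" using nv by (simp add: field_simps)
    then show ?thesis using npt[of "g \<sigma>" z] that by (simp add: T_def)
  qed
  have gv_in: "g \<sigma> *s v \<in> ball 0 e" if "\<sigma> \<in> ball 0 \<rho>" for \<sigma>
  proof -
    have "norm (g \<sigma>) < e / (2 * norm v)" using \<rho>0(2)[of \<sigma>] that g(3) by (simp add: \<rho>_def)
    then have "norm (g \<sigma>) * norm v < e / 2" using nv by (simp add: field_simps)
    then show ?thesis using e by (simp add: norm_scalar_mult)
  qed
  define E where "E \<sigma> z = h (pt (g \<sigma>) z) - h 0" for \<sigma> z
  \<comment> \<open>An arbitrary, in general discontinuous, choice of roots: \<open>H_eq\<close> shows that the choice does not matter.\<close>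
  define rt where "rt t = (SOME \<sigma>. \<sigma> ^ \<nu> = t)" for t :: complex
  have rt: "rt t ^ \<nu> = t" for t
  proof -
    have "\<exists>\<sigma>::complex. \<sigma> ^ \<nu> = t" using exists_complex_root[of \<nu> t] \<nu> by (metis less_numeral_extra(3))
    then show ?thesis unfolding rt_def by (rule someI_ex)
  qed
  let ?Z = "{w::complex. w ^ \<nu> = 1}"
  have Z: "finite ?Z" "1 \<in> ?Z" using \<nu> by auto
  have nZ: "norm w = 1" if "w \<in> ?Z" for w
  proof -
    have "norm w ^ \<nu> = 1 ^ \<nu>" using that by (simp flip: norm_power)
    then show ?thesis using power_eq_imp_eq_base[of "norm w" \<nu> 1] \<nu> by simp
  qed
  define H where "H t z = (\<Prod>w\<in>?Z. E (w * rt t) z)" for t z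
  have H_eq: "H t z = (\<Prod>w\<in>?Z. E (w * \<sigma>) z)" if "\<sigma> ^ \<nu> = t" for \<sigma> t z
    unfolding H_def using prod_roots_of_unity_shift[OF \<nu>, of "rt t" \<sigma> "\<lambda>\<sigma>. E \<sigma> z"] that rt by simp
  obtain rU where rU: "rU > 0" "ball (0::complex) rU \<subseteq> eball 0 (fps_conv_radius U)"
  proof -
    have "(0::complex) \<in> eball 0 (fps_conv_radius U)" using U by (simp add: in_eball_iff zero_ereal_def[symmetric])
    then show thesis using that open_contains_ball[of "eball (0::complex) (fps_conv_radius U)"] open_eball by blast
  qed
  \<comment> \<open>All \<open>\<nu>\<close>-th roots of points of \<open>S\<close> lie in the disc where \<open>pt (g \<sigma>) z\<close> stays in the domain of \<open>h\<close>.\<close>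
  define S where "S = ball (0::complex) (min (\<rho> ^ \<nu>) rU)"
  have S0: "0 \<in> S" using \<rho> rU by (simp add: S_def)
  have root_in: "w * \<sigma> \<in> ball 0 \<rho>" if "\<sigma> ^ \<nu> \<in> S" "w \<in> ?Z" for \<sigma> w
  proof -
    have "norm \<sigma> ^ \<nu> < \<rho> ^ \<nu>" using that by (simp add: S_def norm_power)
    then have "norm \<sigma> < \<rho>" using \<rho> by (meson less_imp_le power_less_imp_less_base)
    then show ?thesis using nZ[OF that(2)] by (simp add: norm_mult)
  qed
  let ?H = "\<lambda>q::complex^2. H (vec_nth q 1) (vec_nth q 2)"
  \<comment> \<open>Away from \<open>t = 0\<close>, replace \<open>rt\<close> by a holomorphic branch of the root near \<open>t0\<close>.\<close>
  have off: "first_integral_at (omega_form n p \<alpha> U) ?H (point2 t0 z0)"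
    if t0: "t0 \<in> S" "t0 \<noteq> 0" and z0: "z0 \<in> T" for t0 z0
  proof -
    obtain b d where b: "b t0 = rt t0" "(b has_field_derivative d) (at t0)"
      "\<And>t. t \<noteq> 0 \<Longrightarrow> b t ^ \<nu> = t"
      using local_root_branch[OF \<nu> t0(2) rt] by metis
    have wb: "w * b t0 \<in> ball 0 \<rho>" if "w \<in> ?Z" for w
      using root_in[of "b t0" w] b(3)[OF t0(2)] t0(1) that by simp
    have "first_integral_at (omega_form n p \<alpha> U)
       (\<lambda>q. \<Prod>w\<in>?Z. h (pt (g (w * b (vec_nth q 1))) (vec_nth q 2)) - h 0) (point2 t0 z0)"
    proof (intro first_integral_at_prod first_integral_at_diff_const)
      fix w assume w: "w \<in> ?Z"
      have "(g has_field_derivative deriv g (w * b t0)) (at (w * b t0))"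
        using holomorphic_derivI[OF g(1) open_ball] wb[OF w] \<rho>(2) by simp
      moreover have "((\<lambda>t. w * b t) has_field_derivative (w * d)) (at t0)"
        using b(2) by (auto intro!: derivative_eq_intros)
      ultimately have gd: "((\<lambda>t. g (w * b t)) has_field_derivative (deriv g (w * b t0) * (w * d))) (at t0)"
        by (rule DERIV_chain2)
      have "isCont (\<lambda>t. w * b t) t0"
        using b(2) by (intro continuous_intros) (rule DERIV_isCont)
      then have "\<forall>\<^sub>F t in nhds t0. w * b t \<in> ball 0 \<rho>"
        using wb[OF w] by (metis open_ball isCont_def tendsto_at_iff_tendsto_nhds topological_tendstoD)
      moreover have "\<forall>\<^sub>F t in nhds t0. t \<noteq> 0" using t0(2) by (simp add: t1_space_nhds)
      ultimately have "\<forall>\<^sub>F t in nhds t0. f (g (w * b t) *s v) = t"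
        by eventually_elim (use \<rho>(2) w b(3) in \<open>simp add: fg power_mult_distrib\<close>)
      from first_integral_at_section[OF f(1)[OF gv_in[OF wb[OF w]]] gd this
          h[OF pt_in[OF wb[OF w] z0], unfolded pt_def]]
      show "first_integral_at (omega_form n p \<alpha> U)
         (\<lambda>q. h (pt (g (w * b (vec_nth q 1))) (vec_nth q 2))) (point2 t0 z0)"
        unfolding pt_def .
    qed (rule Z)
    then show ?thesis
    proof (rule first_integral_at_transform)
      have "isCont (\<lambda>q::complex^2. vec_nth q 1) (point2 t0 z0)" by simp
      then have "((\<lambda>q::complex^2. vec_nth q 1) \<longlongrightarrow> t0) (nhds (point2 t0 z0))"
        by (simp add: isCont_def tendsto_nhds_iff)
      then have "\<forall>\<^sub>F q in nhds (point2 t0 z0). vec_nth q 1 \<noteq> (0::complex)"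
        using t0(2) by (rule tendsto_imp_eventually_ne)
      then show "\<forall>\<^sub>F q in nhds (point2 t0 z0).
        (\<Prod>w\<in>?Z. h (pt (g (w * b (vec_nth q 1))) (vec_nth q 2)) - h 0) = ?H q"
        by eventually_elim (simp add: H_eq[OF b(3)] E_def)
    qed
  qed
  have Tprop: "open T" "convex T" "0 \<in> T" using e by (auto simp: T_def)
  have Sprop: "open S" by (simp add: S_def)
  have holz: "H t holomorphic_on T" if t: "t \<in> S" for t
  proof -
    have "(\<lambda>z. h (g (w * rt t) *s lift_x v + z *s axis None 1)) holomorphic_on T" if w: "w \<in> ?Z" for w
    proof (rule holomorphic_on_subset[OF holomorphic_on_line])
      show "T \<subseteq> {z. g (w * rt t) *s lift_x v + z *s axis None 1 \<in> ball 0 e}"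
        using pt_in[OF root_in[of "rt t" w]] w t rt by (auto simp: pt_def)
    qed (rule hcd)
    then show ?thesis unfolding H_def E_def pt_def by (intro holomorphic_intros)
  qed
  \<comment> \<open>All roots of \<open>t\<close> tend to 0 with \<open>t\<close>, so \<open>H\<close> is continuous over \<open>t = 0\<close> although \<open>rt\<close> may
    jump elsewhere.\<close>
  have rt_lim: "(rt \<longlongrightarrow> 0) (at 0)"
  proof -
    have "norm (rt t) = root \<nu> (norm t)" for t
    proof -
      have "norm t = norm (rt t) ^ \<nu>" by (subst rt[of t, symmetric]) (rule norm_power)
      then show ?thesis using \<nu> by (simp add: real_root_power_cancel)
    qed
    moreover have "((\<lambda>t::complex. root \<nu> (norm t)) \<longlongrightarrow> root \<nu> (norm (0::complex))) (at 0)"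
      by (intro tendsto_intros)
    ultimately have "((\<lambda>t. norm (rt t)) \<longlongrightarrow> 0) (at 0)" by simp
    then show ?thesis by (rule tendsto_norm_zero_cancel)
  qed
  have cont: "continuous_on (S \<times> T) (\<lambda>(t,z). H t z)"
  proof (rule continuous_at_imp_continuous_on, clarify)
    fix t z assume tz: "t \<in> S" "z \<in> T"
    show "isCont (\<lambda>(t,z). H t z) (t, z)"
    proof (cases "t = 0")
      case False
      have "isCont ?H (point2 t z)"
        using off[OF tz(1) False tz(2)] by (intro complex_diff_at_imp_isCont first_integral_at_imp_complex_diff)
      moreover have pc: "isCont (\<lambda>x. point2 (fst x) (snd x)) (t, z)"
        unfolding point2_def
        by (intro continuous_add bounded_linear.isCont[OF linear_scalar_line]
            isCont_fst isCont_snd continuous_ident)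
      ultimately show ?thesis
        using isCont_o2[OF pc, of ?H] by (simp add: case_prod_unfold)
    next
      case True
      have rt0: "rt 0 = 0" using rt[of 0] \<nu> by simp
      have rtc: "isCont rt 0" using rt_lim rt0 by (simp add: isCont_def)
      have "isCont (\<lambda>x::complex \<times> complex. fst x) (0, z)"
        by (intro isCont_fst continuous_ident)
      from isCont_o2[OF this, of rt] rtc have "isCont (\<lambda>x. rt (fst x)) (0, z)" by simp
      then have 1: "isCont (\<lambda>x. w * rt (fst x)) (0, z)" for w
        by (intro continuous_mult continuous_const)
      have 2: "isCont (\<lambda>x. g (w * rt (fst x))) (0, z)" for w
        using isCont_o2[OF 1[of w], of g] g_lim rt0 by simp
      have 3: "isCont (\<lambda>x::complex \<times> complex. pt (g (w * rt (fst x))) (snd x)) (0, z)" for w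
        unfolding pt_def
        by (intro continuous_add bounded_linear.isCont[OF linear_scalar_line] 2 isCont_snd continuous_ident)
      have 4: "isCont (\<lambda>x. h (pt (g (w * rt (fst x))) (snd x))) (0, z)" if "w \<in> ?Z" for w
      proof (rule isCont_o2[OF 3])
        have "pt (g (w * rt 0)) z \<in> ball 0 e" using pt_in[of 0 z] \<rho> tz rt0 by simp
        then show "isCont h (pt (g (w * rt (fst (0, z)))) (snd (0, z)))"
          using hcd complex_diff_at_imp_isCont by auto
      qed
      have "isCont (\<lambda>x. \<Prod>w\<in>?Z. h (pt (g (w * rt (fst x))) (snd x)) - h 0) (0, z)"
        using 4 by (intro continuous_prod continuous_diff continuous_const) auto
      then show ?thesis using True by (simp add: case_prod_unfold H_def E_def)
    qed
  qed
  have all: "first_integral_at (omega_form n p \<alpha> U) ?H (point2 t z)" if "t \<in> S" "z \<in> T" for t z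
  proof (rule first_integral_extends_across_line[OF Sprop Tprop(1,2) cont holz
        _ _ _ off that])
    show "omega_form n p \<alpha> U (point2 t z) u =
       (of_nat n * t ^ (n - 1)) * vec_nth u 1 + (2 * z + \<alpha> * t ^ p * eval_fps U t) * vec_nth u 2" for t z u
      by (simp add: omega_form_eq)
    have "S \<subseteq> eball 0 (fps_conv_radius U)" using rU(2) by (auto simp: S_def subset_iff)
    then have "continuous_on S (eval_fps U)"
      by (rule continuous_on_subset[OF continuous_on_eval_fps])
    then show "continuous_on S (\<lambda>t. 2 * z + \<alpha> * t ^ p * eval_fps U t)" for z
      by (intro continuous_on_add continuous_on_mult continuous_on_const continuous_on_power continuous_on_id)
    show "continuous_on S (\<lambda>t. of_nat n * t ^ (n - 1))"
      by (intro continuous_on_mult continuous_on_const continuous_on_power continuous_on_id)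
  qed
  have nonconst: "\<not> (\<forall>\<^sub>F q in nhds 0. ?H q = ?H 0)"
  proof
    assume "\<forall>\<^sub>F q in nhds 0. ?H q = ?H 0"
    moreover have "H 0 0 = 0"
    proof -
      have "E (1 * 0) 0 = 0" by (simp add: E_def pt_def g(3))
      then have "(\<Prod>w\<in>?Z. E (w * 0) 0) = 0" by (rule prod_zero[OF Z(1) bexI[OF _ Z(2)]])
      moreover have "(0::complex) ^ \<nu> = 0" using \<nu> by simp
      ultimately show ?thesis by (simp only: H_eq[of 0 0 0])
    qed
    ultimately have "\<forall>\<^sub>F q in nhds 0. ?H q = 0" by simp
    then obtain \<kappa> where \<kappa>: "\<kappa> > 0" "\<And>q. dist q 0 < \<kappa> \<Longrightarrow> ?H q = 0"
      unfolding eventually_nhds_metric by blast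
    have H0: "H t z = 0" if "norm t < \<kappa> / 2" "norm z < \<kappa> / 2" for t z
    proof -
      have "norm (point2 t z) \<le> norm t + norm z"
        using norm_triangle_ineq[of "t *s axis 1 1 :: complex^2" "z *s axis 2 1"]
        by (simp add: point2_def norm_scalar_mult)
      then show ?thesis using \<kappa>(2)[of "point2 t z"] that by simp
    qed
    \<comment> \<open>On the line through \<open>q0\<close> there are arbitrarily small points \<open>s *s q0\<close> with \<open>h (s *s q0) \<noteq> h 0\<close>; they
      lie in the plane to which \<open>h\<close> was restricted, and their \<open>z\<close>-coordinate is fixed as \<open>z1\<close>.\<close>
    let ?L = "{s. 0 + s *s q0 \<in> ball 0 e}"
    have "\<forall>\<^sub>F s in at 0. h (0 + s *s q0) - h 0 \<noteq> 0"
    proof (rule holomorphic_nonzero_nearby)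
      show "(\<lambda>s. h (0 + s *s q0) - h 0) holomorphic_on ?L"
        by (intro holomorphic_intros holomorphic_on_line) (rule hcd)
      show "open ?L" by (rule open_line_preimage[OF open_ball])
      show "connected ?L" by (intro convex_connected convex_line_preimage convex_ball)
      show "0 \<in> ?L" "1 \<in> ?L" using q0 e by auto
      show "h (0 + 1 *s q0) - h 0 \<noteq> 0" using q0 by simp
    qed
    moreover have "\<forall>\<^sub>F s in at 0. s \<in> g ` ball 0 \<rho>"
    proof (rule eventually_at_in_open')
      show "open (g ` ball 0 \<rho>)"
        using \<rho>(2) by (intro open_mapping_thm3 holomorphic_on_subset[OF g(1)] inj_on_subset[OF g(2)]) auto
      show "0 \<in> g ` ball 0 \<rho>" using g(3) \<rho>(1) by (intro image_eqI[of _ _ 0]) auto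
    qed
    moreover have "\<forall>\<^sub>F s in at 0. norm (s * z_coord q0) < min (\<kappa> / 2) (e / 2)"
    proof -
      have "((\<lambda>s. norm (s * z_coord q0)) \<longlongrightarrow> norm (0 * z_coord q0)) (at 0)" by (intro tendsto_intros)
      then show ?thesis using \<kappa>(1) e by (intro order_tendstoD) auto
    qed
    ultimately have "\<forall>\<^sub>F s in at 0. h (s *s q0) \<noteq> h 0 \<and> s \<in> g ` ball 0 \<rho> \<and>
       norm (s * z_coord q0) < min (\<kappa> / 2) (e / 2)"
      by eventually_elim simp
    then obtain s where s: "h (s *s q0) \<noteq> h 0" "s \<in> g ` ball 0 \<rho>"
      "norm (s * z_coord q0) < min (\<kappa> / 2) (e / 2)"
      using eventually_happens trivial_limit_at by blast
    then obtain \<sigma>1 where \<sigma>1: "\<sigma>1 \<in> ball 0 \<rho>" "s = g \<sigma>1" by blast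
    define z1 where "z1 = s * z_coord q0"
    have z1: "z1 \<in> T" "norm z1 < \<kappa> / 2" using s(3) by (auto simp: z1_def T_def)
    have "pt (g \<sigma>1) z1 = s *s q0"
      using coordinates_scaled[of s q0] \<sigma>1(2) by (simp add: pt_def z1_def v_def)
    then have E1: "E \<sigma>1 z1 \<noteq> 0" using s(1) by (simp add: E_def)
    \<comment> \<open>With \<open>z1\<close> fixed, no factor of \<open>H\<close> vanishes identically in \<open>\<sigma>\<close>, since the factor of \<open>w\<close> is nonzero
      at \<open>\<sigma>1 / w\<close>; so for small \<open>\<sigma> \<noteq> 0\<close> the whole product is nonzero.\<close>
    have "\<forall>\<^sub>F \<sigma> in at 0. E (w * \<sigma>) z1 \<noteq> 0" if w: "w \<in> ?Z" for w
    proof (rule holomorphic_nonzero_nearby)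
      have w0: "w \<noteq> 0" using nZ[OF w] by auto
      show "\<sigma>1 / w \<in> ball 0 \<rho>" using \<sigma>1 nZ[OF w] by (simp add: norm_divide)
      show "E (w * (\<sigma>1 / w)) z1 \<noteq> 0" using E1 w0 by simp
      have "(\<lambda>s. h (z1 *s axis None 1 + s *s lift_x v)) holomorphic_on
         {s. z1 *s axis None 1 + s *s lift_x v \<in> ball 0 e}"
        by (rule holomorphic_on_line) (rule hcd)
      moreover have "(\<lambda>\<sigma>. g (w * \<sigma>)) holomorphic_on ball 0 \<rho>"
      proof -
        have "(g \<circ> (\<lambda>\<sigma>. w * \<sigma>)) holomorphic_on ball 0 \<rho>"
          using nZ[OF w] \<rho>(2) by (intro holomorphic_on_compose_gen[OF _ g(1)] holomorphic_intros) (auto simp: norm_mult)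
        then show ?thesis by (simp add: o_def)
      qed
      moreover have "(\<lambda>\<sigma>. g (w * \<sigma>)) ` ball 0 \<rho> \<subseteq> {s. z1 *s axis None 1 + s *s lift_x v \<in> ball 0 e}"
        using pt_in[OF _ z1(1), of "w * _"] nZ[OF w] by (auto simp: pt_def norm_mult add.commute)
      ultimately have "((\<lambda>s. h (z1 *s axis None 1 + s *s lift_x v)) \<circ> (\<lambda>\<sigma>. g (w * \<sigma>))) holomorphic_on ball 0 \<rho>"
        by (intro holomorphic_on_compose_gen)
      then show "(\<lambda>\<sigma>. E (w * \<sigma>) z1) holomorphic_on ball 0 \<rho>"
        unfolding E_def pt_def o_def by (intro holomorphic_intros) (simp add: add.commute)
    qed (use \<rho> in auto)
    then have "\<forall>\<^sub>F \<sigma> in at 0. \<forall>w\<in>?Z. E (w * \<sigma>) z1 \<noteq> 0"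
      by (intro eventually_ball_finite Z(1)) blast
    moreover have "\<forall>\<^sub>F \<sigma>::complex in at 0. norm (\<sigma> ^ \<nu>) < \<kappa> / 2"
    proof -
      have "((\<lambda>\<sigma>::complex. norm (\<sigma> ^ \<nu>)) \<longlongrightarrow> norm (0 ^ \<nu> :: complex)) (at 0)" by (intro tendsto_intros)
      then show ?thesis using \<kappa>(1) \<nu> by (intro order_tendstoD) (auto simp: power_0_left)
    qed
    ultimately have "\<forall>\<^sub>F \<sigma>::complex in at 0. False"
    proof eventually_elim
      case (elim \<sigma>)
      have "H (\<sigma> ^ \<nu>) z1 \<noteq> 0" using elim(1) Z(1) by (subst H_eq[OF refl]) simp
      then show False using H0[OF elim(2) z1(2)] by simp
    qed
    then show False by simp
  qed
  have "\<forall>\<^sub>F q in nhds 0. first_integral_at (omega_form n p \<alpha> U) ?H q"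
  proof -
    obtain d where d: "d > 0" "ball 0 d \<subseteq> S \<inter> T"
      using open_contains_ball[of "S \<inter> T"] Sprop Tprop S0 by blast
    have "first_integral_at (omega_form n p \<alpha> U) ?H q" if "dist q 0 < d" for q
      using all[of "vec_nth q 1" "vec_nth q 2"] d(2) that Finite_Cartesian_Product.norm_nth_le[of q 1] Finite_Cartesian_Product.norm_nth_le[of q 2]
      by (force simp: point2_eta subset_iff)
    then show ?thesis unfolding eventually_nhds_metric using d(1) by blast
  qed
  with nonconst show ?thesis unfolding holomorphic_first_integral_iff by blast
qed

theorem theorem3:
  fixes f :: "complex^'m::finite \<Rightarrow> complex"
    and n p k :: nat
    and \<alpha> :: complex
    and U :: "complex fps"
    and F :: "nat \<Rightarrow> 'm hgerm"
    and r :: "nat \<Rightarrow> nat"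
  assumes "n \<ge> 1" and "p \<ge> 1"
    and "\<alpha> \<noteq> 0"
    and "fps_conv_radius U > 0" and "fps_nth U 0 = 1"
    and "holomorphic_at_0 f" and "f 0 = 0" and "hgerm_of f \<noteq> 0"
    and "hgerm_of f = (\<Prod>i<k. F i ^ r i)"
    and "\<And>i. i < k \<Longrightarrow> irreducible (F i)"
    and "\<And>i j. i < k \<Longrightarrow> j < k \<Longrightarrow> i \<noteq> j \<Longrightarrow> \<not> (F i dvd F j \<and> F j dvd F i)"
    and "\<And>i. i < k \<Longrightarrow> r i \<ge> 1"
    and "Gcd (r ` {..<k}) = 1"
    and "has_first_order_part (Omega_form f n p \<alpha> U) (\<lambda>q u. 2 * z_coord q * ext_d z_coord q u)"
  shows "(\<exists>h. holomorphic_first_integral (Omega_form f n p \<alpha> U) h) \<longleftrightarrow>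
         (\<exists>h. holomorphic_first_integral (omega_form n p \<alpha> U) h)"
proof
  note f = \<open>holomorphic_at_0 f\<close> \<open>f 0 = 0\<close>
  have nz: "\<not> (\<forall>\<^sub>F x in nhds 0. f x = 0)"
    using \<open>holomorphic_at_0 f\<close> \<open>hgerm_of f \<noteq> 0\<close> by (rule germ_nonzero)
  {
    assume "\<exists>h. holomorphic_first_integral (omega_form n p \<alpha> U) h"
    then show "\<exists>h. holomorphic_first_integral (Omega_form f n p \<alpha> U) h"
      using first_integral_pullback_by_germ[OF f nz] by blast
  }
  assume "\<exists>h. holomorphic_first_integral (Omega_form f n p \<alpha> U) h"
  then obtain h where h: "\<forall>\<^sub>F q in nhds 0. first_integral_at (Omega_form f n p \<alpha> U) h q"
    "\<not> (\<forall>\<^sub>F q in nhds 0. h q = h 0)"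
    unfolding holomorphic_first_integral_iff by blast
  obtain e1 where e1: "e1 > 0" "\<And>x. x \<in> ball 0 e1 \<Longrightarrow> complex_diff_at f x"
    using f(1) unfolding holomorphic_at_0_def complex_diff_at_def[symmetric] eventually_nhds_ball
    by blast
  obtain e2 where e2: "e2 > 0"
    "\<And>q. q \<in> ball 0 e2 \<Longrightarrow> first_integral_at (Omega_form f n p \<alpha> U) h q"
    using h(1) unfolding eventually_nhds_ball by blast
  define e where "e = min e1 e2"
  have e: "e > 0" using e1 e2 by (simp add: e_def)
  have fe: "complex_diff_at f x" if "x \<in> ball 0 e" for x
    using e1(2) that by (simp add: e_def)
  have he: "first_integral_at (Omega_form f n p \<alpha> U) h q" if "q \<in> ball 0 e" for q
    using e2(2) that by (simp add: e_def)
  have hc: "isCont h q" if "q \<in> ball 0 e" for q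
    using he[OF that] by (intro complex_diff_at_imp_isCont first_integral_at_imp_complex_diff)
  obtain q0 where "q0 \<in> ball 0 e" "h q0 \<noteq> h 0" "f (x_coord q0) \<noteq> 0"
    by (rule exists_generic_point[OF fe nz hc h(2) e])
  then show "\<exists>h. holomorphic_first_integral (omega_form n p \<alpha> U) h"
    using first_integral_descends[OF \<open>fps_conv_radius U > 0\<close> e fe f(2) he] by blast
qed

end
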